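(* For rule $2$ on the triangular grid, the problem \textsc{Stability} is in $\mathbf{NC}$.
   Context: Triangular grid: the plane tessellated by equilateral triangles; each triangle (cell) has three neighbors, namely the triangles sharing an edge with it; $N(u)$ denotes the set of neighbors of $u$. A configuration assigns to every cell a state in $\{0,1\}$ (1 = active, 0 = inactive). A freezing totalistic cellular automaton is given by a set $\mathcal{I}\subseteq\{1,2,3\}$ and acts synchronously by $F(c)_u=1$ if $c_u=1$ or $\sum_{v\in N(u)}c_v\in\mathcal{I}$, and $F(c)_u=0$ otherwise; rule $2$ means $\mathcal{I}=\{2\}$. A finite configuration $x$ of dimension $n\times n$ assigns states to a rhombus-shaped region of $2n^2$ triangles, and $c(x)$ is the periodic configuration obtained by repeating $x$ in all directions (a torus). A cell $u$ with $c_u=0$ is stable for $c$ if $F^t(c)_u=0$ for all $t\ge0$. \textsc{Stability}: given $x$ and a cell $u$ of the region with $x_u=0$, decide whether $u$ is stable for $c(x)$. $\mathbf{NC}$ is the class of decision problems solvable on a PRAM in time $(\log n)^{O(1)}$ with $n^{O(1)}$ processors. *)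

theory Defs
  imports "HOL-Library.Log_Nat"
begin

section \<open>Freezing totalistic cellular automata on the triangular grid\<close>

text \<open>
  The vertices of the tessellation are the points \<open>i e\<^sub>1 + j e\<^sub>2\<close> for integers \<open>i\<close>, \<open>j\<close>,
  where \<open>e\<^sub>1\<close>, \<open>e\<^sub>2\<close> are unit vectors at an angle of 60 degrees.
  The rhombus with lower left vertex \<open>(i, j)\<close> is cut by its short diagonal into
  the triangles \<open>Up i j\<close> and \<open>Down i j\<close>.
\<close>

datatype cell = Up int int | Down int int

fun corners :: "cell \<Rightarrow> (int \<times> int) set" where
  "corners (Up i j) = {(i, j), (i + 1, j), (i, j + 1)}"
| "corners (Down i j) = {(i + 1, j), (i, j + 1), (i + 1, j + 1)}"

text \<open>Two triangles share an edge iff they have exactly two corners in common.\<close>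

definition nbrs :: "cell \<Rightarrow> cell set" where
  "nbrs u = {v. card (corners u \<inter> corners v) = 2}"

lemma nbrs_Up: "nbrs (Up i j) = {Down i j, Down (i - 1) j, Down i (j - 1)}"
proof (rule set_eqI)
  fix v
  show "v \<in> nbrs (Up i j) \<longleftrightarrow> v \<in> {Down i j, Down (i - 1) j, Down i (j - 1)}"
    by (cases v) (auto simp: nbrs_def Int_insert_left card_insert_if split: if_splits)
qed

lemma nbrs_Down: "nbrs (Down i j) = {Up i j, Up (i + 1) j, Up i (j + 1)}"
proof (rule set_eqI)
  fix v
  show "v \<in> nbrs (Down i j) \<longleftrightarrow> v \<in> {Up i j, Up (i + 1) j, Up i (j + 1)}"
    by (cases v) (auto simp: nbrs_def Int_insert_left card_insert_if split: if_splits)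
qed

type_synonym config = "cell \<Rightarrow> bool"

definition ca_step :: "nat set \<Rightarrow> config \<Rightarrow> config" where
  "ca_step I c = (\<lambda>u. c u \<or> (\<Sum>v\<in>nbrs u. of_bool (c v)) \<in> I)"

definition stable :: "nat set \<Rightarrow> config \<Rightarrow> cell \<Rightarrow> bool" where
  "stable I c u \<longleftrightarrow> (\<forall>t. \<not> (ca_step I ^^ t) c u)"

section \<open>The decision problem\<close>

definition region :: "nat \<Rightarrow> cell set" where
  "region n = (\<Union>i\<in>{0..<int n}. \<Union>j\<in>{0..<int n}. {Up i j, Down i j})"

text \<open>
  A finite configuration of dimension \<open>n \<times> n\<close> is given by a total function of which
  only the values on \<open>region n\<close> are used.
\<close>

fun periodic :: "nat \<Rightarrow> config \<Rightarrow> config" where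
  "periodic n x (Up i j) = x (Up (i mod int n) (j mod int n))"
| "periodic n x (Down i j) = x (Down (i mod int n) (j mod int n))"

definition region_list :: "nat \<Rightarrow> cell list" where
  "region_list n =
     concat (map (\<lambda>i. concat (map (\<lambda>j. [Up i j, Down i j]) [0..int n - 1])) [0..int n - 1])"

lemma set_region_list: "set (region_list n) = region n"
  by (auto simp: region_list_def region_def)

text \<open>
  An instance is written as the \<open>2n\<^sup>2\<close> states of the region followed by
  \<open>2n\<^sup>2\<close> bits which mark the queried cell.  The dimension is determined by the
  length \<open>4n\<^sup>2\<close>.  Strings that encode no instance are not in the language.
\<close>

definition encode :: "nat \<Rightarrow> config \<Rightarrow> cell \<Rightarrow> bool list" where
  "encode n x u = map x (region_list n) @ map (\<lambda>v. v = u) (region_list n)"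

definition Stability :: "nat set \<Rightarrow> bool list set" where
  "Stability I =
     {encode n x u | n x u. 1 \<le> n \<and> u \<in> region n \<and> \<not> x u \<and> stable I (periodic n x) u}"

section \<open>Parallel random access machines and NC\<close>

text \<open>
  Synchronous processors run a common program.  Each has its own program counter and
  registers, and all access a shared memory.  Words have a bounded length of
  logarithmically many bits, results of arithmetic operations are reduced modulo \<open>W\<close>,
  the number of words.  Hence unit cost multiplication and division are harmless.
  As a program is fixed, an instruction evaluates an expression of constant size.
\<close>

datatype exp =
    Const nat
  | Reg nat
  | Plus exp exp
  | Minus exp exp
  | Times exp exp
  | Div exp exp
  | Mod exp exp
  | Equal exp exp
  | Less exp exp

fun eval :: "nat \<Rightarrow> (nat \<Rightarrow> nat) \<Rightarrow> exp \<Rightarrow> nat" where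
  "eval W r (Const k) = k mod W"
| "eval W r (Reg k) = r k"
| "eval W r (Plus d e) = (eval W r d + eval W r e) mod W"
| "eval W r (Minus d e) = eval W r d - eval W r e"
| "eval W r (Times d e) = (eval W r d * eval W r e) mod W"
| "eval W r (Div d e) = eval W r d div eval W r e"
| "eval W r (Mod d e) = eval W r d mod eval W r e"
| "eval W r (Equal d e) = of_bool (eval W r d = eval W r e)"
| "eval W r (Less d e) = of_bool (eval W r d < eval W r e)"

datatype instr =
    Assign nat exp    \<comment> \<open>register, value\<close>
  | Read nat exp      \<comment> \<open>register, address\<close>
  | Write exp exp     \<comment> \<open>address, value\<close>
  | Branch exp nat    \<comment> \<open>jump to the label if the value is not 0\<close>

record pram =
  pc :: "nat \<Rightarrow> nat"            \<comment> \<open>indexed by processors\<close>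
  regs :: "nat \<Rightarrow> nat \<Rightarrow> nat"   \<comment> \<open>indexed by processors and register names\<close>
  mem :: "nat \<Rightarrow> nat"

text \<open>A processor has halted when its program counter points behind the program.\<close>

definition fetch :: "instr list \<Rightarrow> pram \<Rightarrow> nat \<Rightarrow> instr option" where
  "fetch P s i = (if pc s i < length P then Some (P ! pc s i) else None)"

definition next_pc :: "nat \<Rightarrow> instr list \<Rightarrow> pram \<Rightarrow> nat \<Rightarrow> nat" where
  "next_pc W P s i =
     (case fetch P s i of
        None \<Rightarrow> pc s i
      | Some (Branch e l) \<Rightarrow> if eval W (regs s i) e \<noteq> 0 then l else Suc (pc s i)
      | Some _ \<Rightarrow> Suc (pc s i))"

definition next_regs :: "nat \<Rightarrow> instr list \<Rightarrow> pram \<Rightarrow> nat \<Rightarrow> nat \<Rightarrow> nat" where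
  "next_regs W P s i =
     (case fetch P s i of
        Some (Assign k e) \<Rightarrow> (regs s i)(k := eval W (regs s i) e)
      | Some (Read k e) \<Rightarrow> (regs s i)(k := mem s (eval W (regs s i) e))
      | _ \<Rightarrow> regs s i)"

definition write_request :: "nat \<Rightarrow> instr list \<Rightarrow> pram \<Rightarrow> nat \<Rightarrow> (nat \<times> nat) option" where
  "write_request W P s i =
     (case fetch P s i of
        Some (Write d e) \<Rightarrow> Some (eval W (regs s i) d, eval W (regs s i) e)
      | _ \<Rightarrow> None)"

text \<open>
  Concurrent reads and writes are allowed; among the processors \<open>i < p\<close> that write to
  the same address in the same step the one with the least number succeeds
  (priority CRCW).  The conventions for access conflicts do not affect NC.
\<close>

definition next_mem :: "nat \<Rightarrow> nat \<Rightarrow> instr list \<Rightarrow> pram \<Rightarrow> nat \<Rightarrow> nat" where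
  "next_mem W p P s a =
     (let writes = (\<lambda>i. i < p \<and> (\<exists>v. write_request W P s i = Some (a, v)))
      in if \<exists>i. writes i then snd (the (write_request W P s (LEAST i. writes i)))
         else mem s a)"

definition pram_step :: "nat \<Rightarrow> nat \<Rightarrow> instr list \<Rightarrow> pram \<Rightarrow> pram" where
  "pram_step W p P s =
     \<lparr>pc = next_pc W P s, regs = next_regs W P s, mem = next_mem W p P s\<rparr>"

text \<open>
  Initially every processor knows its number and the input length, and the input is
  stored in the shared memory.
\<close>

definition pram_init :: "bool list \<Rightarrow> pram" where
  "pram_init x =
     \<lparr>pc = (\<lambda>i. 0),
      regs = (\<lambda>i. (\<lambda>k. 0)(0 := i, 1 := length x)),
      mem = (\<lambda>a. if a < length x then of_bool (x ! a) else 0)\<rparr>"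

definition halted :: "nat \<Rightarrow> instr list \<Rightarrow> pram \<Rightarrow> bool" where
  "halted p P s \<longleftrightarrow> (\<forall>i<p. fetch P s i = None)"

definition lg :: "nat \<Rightarrow> nat" where
  "lg n = floorlog 2 (n + 2)"   \<comment> \<open>the number of binary digits of \<open>n + 2\<close>\<close>

text \<open>
  On inputs of length \<open>n\<close> there are \<open>(n + 2)\<^sup>a\<close> processors and words of \<open>b \<cdot> lg n\<close> bits;
  \<open>0 < a \<le> b\<close> guarantees that the processor numbers and the input length are words.
\<close>

definition NC :: "bool list set set" where
  "NC = {L. \<exists>P a b c. 0 < a \<and> a \<le> b \<and>
     (\<forall>x. let n = length x; p = (n + 2) ^ a; W = 2 ^ (b * lg n) in
        \<exists>t \<le> c * lg n ^ c.
          let s = (pram_step W p P ^^ t) (pram_init x) in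
            halted p P s \<and> (mem s 0 = 1 \<longleftrightarrow> x \<in> L))}"

end

theory Submission
  imports Defs
begin

text \<open>
  For rule 2 the inactive cells form a graph of degree at most 3 from which the vertices of degree
  exactly 1 are removed synchronously.  As long as \<open>u\<close> is inactive, its neighbor in direction \<open>d\<close>
  is inactive at time \<open>t\<close> iff there is a non-backtracking walk of length \<open>t + 1\<close> through initially
  inactive cells that starts at \<open>u\<close> in direction \<open>d\<close>.  Hence an inactive cell \<open>u\<close> is stable iff there
  is no \<open>l\<close> for which such walks of length \<open>l\<close> exist in exactly one of the three directions.

  Walks on the torus are paths in a directed graph on \<open>6 n\<^sup>2\<close> darts (cells with a direction).
  The sets of darts that start a walk of length \<open>l\<close> decrease with \<open>l\<close> and are constant after
  \<open>6 n\<^sup>2 + 1\<close> steps, so only polynomially many lengths matter.  The relations ``a walk of length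
  \<open>l\<close> leads from \<open>x\<close> to \<open>y\<close>'' for all these \<open>l\<close> are computed by concatenating walks in logarithmically
  many rounds, with a processor for each way to split a walk into two parts.
\<close>

section \<open>Leaf removal and walks\<close>

text \<open>Directions number the three edge orientations, so an edge has the same number seen from
  both of its cells and \<open>nb\<close> undoes itself for fixed \<open>d\<close>.\<close>

fun nb :: "cell \<Rightarrow> nat \<Rightarrow> cell" where
  "nb (Up i j) d = Down (i - of_bool (d = 1)) (j - of_bool (d = 2))"
| "nb (Down i j) d = Up (i + of_bool (d = 1)) (j + of_bool (d = 2))"

lemma nb_nb [simp]: "nb (nb u d) d = u"
  by (cases u) auto

lemma less_3_cases: "d < 3 \<Longrightarrow> d = 0 \<or> d = 1 \<or> d = (2::nat)"
  by linarith

lemma sum_nbrs: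
  "(\<Sum>v\<in>nbrs u. f v) = f (nb u 0) + f (nb u 1) + (f (nb u 2) :: 'a::comm_monoid_add)"
  by (cases u) (simp_all add: nbrs_Up nbrs_Down add_ac)

lemma ca_step_active: "c u \<Longrightarrow> ca_step I c u"
  by (simp add: ca_step_def)

lemma ca_iter_active: "c u \<Longrightarrow> (ca_step I ^^ t) c u"
  by (induction t) (simp_all add: ca_step_active)

lemma ca_step_2:
  "ca_step {2} c u \<longleftrightarrow>
     c u \<or> of_bool (c (nb u 0)) + of_bool (c (nb u 1)) + of_bool (c (nb u 2)) = (2::nat)"
  by (simp add: ca_step_def sum_nbrs)

text \<open>
  A non-backtracking walk through inactive cells: it has \<open>l\<close> steps, starts at \<open>u\<close> in
  direction \<open>d\<close>, and a step in direction \<open>d\<close> is undone by another one in direction \<open>d\<close>.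
  The state of the starting cell is irrelevant.
\<close>

fun walk :: "config \<Rightarrow> nat \<Rightarrow> cell \<Rightarrow> nat \<Rightarrow> bool" where
  "walk c 0 u d \<longleftrightarrow> True"
| "walk c (Suc l) u d \<longleftrightarrow> \<not> c (nb u d) \<and> (\<exists>d'<3. d' \<noteq> d \<and> walk c l (nb u d) d')"

lemma walk_mono: "walk c (Suc l) u d \<Longrightarrow> walk c l u d"
  by (induction l arbitrary: u d) auto

text \<open>While \<open>u\<close> is inactive, the cell next to it in direction \<open>d\<close>
  has an inactive neighbor, so rule 2 activates it exactly when its other two neighbors are active.
  These are related to that cell as it is to \<open>u\<close>, which gives the recursion of
  \<open>walk\<close>.\<close>

lemma ca_iter_nb:
  assumes "\<not> (ca_step {2} ^^ t) c u" "d < 3"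
  shows "(ca_step {2} ^^ t) c (nb u d) \<longleftrightarrow> \<not> walk c (Suc t) u d"
  using assms
proof (induction t arbitrary: u d)
  case 0
  \<comment> \<open>A walk of length 1 needs an inactive neighbor and merely some second direction,
    which always exists.\<close>
  have "\<exists>d'<3. d' \<noteq> d" by (rule exI[of _ "if d = 0 then 1 else 0"]) auto
  with 0 show ?case by simp
next
  case (Suc t)
  let ?F = "(ca_step {2} ^^ t) c" and ?v = "nb u d"
  have u: "\<not> ?F u" using Suc.prems(1) ca_step_active[of ?F u] by auto
  show ?case
  proof (cases "?F ?v")
    case True
    then have "\<not> walk c (Suc t) u d" using Suc.IH u Suc.prems by blast
    then have "\<not> walk c (Suc (Suc t)) u d" using walk_mono by blast
    with True ca_step_active[of ?F ?v] show ?thesis by simp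
  next
    case False
    have c: "\<not> c ?v" using False ca_iter_active by blast
    have v: "?F (nb ?v d') \<longleftrightarrow> \<not> walk c (Suc t) ?v d'" if "d' < 3" for d'
      using Suc.IH False that by blast
    have opp: "\<not> ?F (nb ?v d)" using u by simp
    have "(ca_step {2} ^^ Suc t) c ?v \<longleftrightarrow>
        of_bool (?F (nb ?v 0)) + of_bool (?F (nb ?v 1)) + of_bool (?F (nb ?v 2)) = (2::nat)"
      using False by (simp add: ca_step_2)
    \<comment> \<open>The neighbor of \<open>?v\<close> in direction \<open>d\<close> is
      \<open>u\<close>, which is inactive; so two active neighbors must be the two others.\<close>
    also have "\<dots> \<longleftrightarrow> (\<forall>d'<3. d' \<noteq> d \<longrightarrow> ?F (nb ?v d'))"
      using less_3_cases[OF Suc.prems(2)] opp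
      by (auto simp: numeral_3_eq_3 less_Suc_eq numeral_2_eq_2 simp del: nb_nb)
    also have "\<dots> \<longleftrightarrow> \<not> walk c (Suc (Suc t)) u d"
      using v c by (subst walk.simps(2)) blast
    finally show ?thesis .
  qed
qed

text \<open>Before its activation, \<open>u\<close> sees at time \<open>t\<close> as many inactive
  neighbors as there are directions with a walk of length \<open>t + 1\<close>; it is activated when
  exactly one neighbor is inactive.\<close>

lemma stable_2_iff:
  assumes "\<not> c u"
  shows "stable {2} c u \<longleftrightarrow>
    (\<forall>l. of_bool (walk c l u 0) + of_bool (walk c l u 1) + of_bool (walk c l u 2) \<noteq> (1::nat))"
    (is "_ \<longleftrightarrow> (\<forall>l. ?N l \<noteq> 1)")
proof -
  have step: "(ca_step {2} ^^ Suc t) c u \<longleftrightarrow> ?N (Suc t) = 1" if "\<not> (ca_step {2} ^^ t) c u" for t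
    using that ca_iter_nb[OF that, of 0] ca_iter_nb[OF that, of 1] ca_iter_nb[OF that, of 2]
    by (simp add: ca_step_2 del: walk.simps)
  have "(\<forall>t. \<not> (ca_step {2} ^^ t) c u) \<longleftrightarrow> (\<forall>t. ?N (Suc t) \<noteq> 1)"
  proof
    assume "\<forall>t. \<not> (ca_step {2} ^^ t) c u"
    then show "\<forall>t. ?N (Suc t) \<noteq> 1" using step by blast
  next
    assume N: "\<forall>t. ?N (Suc t) \<noteq> 1"
    have "\<not> (ca_step {2} ^^ t) c u" for t
    proof (induction t)
      case (Suc t)
      with step N show ?case by blast
    qed (use assms in simp)
    then show "\<forall>t. \<not> (ca_step {2} ^^ t) c u" by blast
  qed
  also have "\<dots> \<longleftrightarrow> (\<forall>l. ?N l \<noteq> 1)"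
  proof -
    \<comment> \<open>Length 0 counts all three directions.\<close>
    have "?N 0 \<noteq> 1" by simp
    then show ?thesis by (metis not0_implies_Suc)
  qed
  finally show ?thesis by (simp add: stable_def)
qed

section \<open>The torus\<close>

definition cell_of :: "nat \<Rightarrow> nat \<Rightarrow> cell" where
  "cell_of n q = (if even q then Up else Down) (int (q div 2 div n)) (int (q div 2 mod n))"

fun index :: "nat \<Rightarrow> cell \<Rightarrow> nat" where
  "index n (Up i j) = 2 * (nat (i mod int n) * n + nat (j mod int n))"
| "index n (Down i j) = 2 * (nat (i mod int n) * n + nat (j mod int n)) + 1"

text \<open>The shift \<open>k\<close> is \<open>n - 1\<close>, that is -1 modulo \<open>n\<close>,
  for upward triangles (\<open>s = 0\<close>) and 1 for downward ones; so no negative numbers occur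
  and a machine expression can follow the formula.\<close>

definition nb_index :: "nat \<Rightarrow> nat \<Rightarrow> nat \<Rightarrow> nat" where
  "nb_index n q d =
     (let s = q mod 2; i = q div 2 div n; j = q div 2 mod n; k = (1 - s) * (n - 1) + s
      in 2 * (((i + of_bool (d = 1) * k) mod n) * n + (j + of_bool (d = 2) * k) mod n) + (1 - s))"

lemma div_mod_combine:
  fixes a b n :: nat
  assumes "b < n"
  shows "(a * n + b) div n = a" "(a * n + b) mod n = b"
  using assms by simp_all

lemma combine_less:
  fixes a b n :: nat
  assumes "a < k" "b < n"
  shows "a * n + b < k * n"
proof -
  have "a * n + b < Suc a * n" using assms by simp
  also have "\<dots> \<le> k * n" using assms by (intro mult_le_mono1) simp
  finally show ?thesis .
qed

lemma index_less: "n > 0 \<Longrightarrow> index n u < 2 * (n * n)"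
proof (cases u)
  assume "n > 0"
  have *: "2 * (nat (i mod int n) * n + nat (j mod int n)) + 1 < 2 * (n * n)" for i j
  proof -
    have "nat (i mod int n) * n + nat (j mod int n) < n * n"
      using \<open>n > 0\<close> by (intro combine_less) (auto simp: nat_less_iff)
    then show ?thesis unfolding mult_2 by linarith
  qed
  { case (Up i j) show ?thesis using *[of i j] Up by simp }
  { case (Down i j) show ?thesis using *[of i j] Down by simp }
qed

lemma nat_mod_add:
  assumes "n > 0"
  shows "(nat (i mod int n) + k) mod n = nat ((i + int k) mod int n)"
  using assms by (simp add: nat_mod_as_int mod_simps) 

lemma nat_mod_pred:
  assumes "n > 0"
  shows "(nat (i mod int n) + (n - 1)) mod n = nat ((i - 1) mod int n)"
proof -
  have "(i + int (n - 1)) mod int n = (i - 1 + int n) mod int n"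
    using assms by (simp add: of_nat_diff algebra_simps)
  also have "\<dots> = (i - 1) mod int n" by simp
  finally show ?thesis using nat_mod_add[OF assms, of i "n - 1"] by simp
qed

text \<open>Indices reduce coordinates modulo \<open>n\<close>, so steps in the plane become steps
  on the torus, with wrap-around at the border.\<close>

lemma index_nb:
  assumes "n > 0"
  shows "index n (nb u d) = nb_index n (index n u) d"
proof (cases u)
  case (Up i j)
  have *: "nat (j mod int n) < n" "nat (i mod int n) < n"
    using assms by (auto simp: nat_less_iff)
  show ?thesis using * nat_mod_pred[OF assms] 
    by (simp add: Up nb_index_def Let_def div_mod_combine)
next
  case (Down i j)
  have *: "nat (j mod int n) < n" "nat (i mod int n) < n"
    using assms by (auto simp: nat_less_iff)
  have d: "(2 * (nat (i mod int n) * n + nat (j mod int n)) + 1) div 2 =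
      nat (i mod int n) * n + nat (j mod int n)" by simp
  have "(2 * (nat (i mod int n) * n + nat (j mod int n)) + 1) mod 2 = 1" by presburger
  then show ?thesis using * nat_mod_add[OF assms, of _ 1]
    unfolding nb_index_def Let_def Down index.simps nb.simps d
    by (simp add: div_mod_combine)
qed

lemma index_cell_of:
  assumes "q < 2 * (n * n)"
  shows "index n (cell_of n q) = q"
proof -
  have n: "n > 0" using assms by (cases n) auto
  have "q div 2 < n * n" using assms by linarith
  then have "q div 2 div n < n" by (simp add: less_mult_imp_div_less)
  then show ?thesis using n
    by (auto simp: cell_of_def nat_mod_distrib simp flip: of_nat_mod)
qed

lemma cell_of_index:
  assumes "n > 0"
  shows "x (cell_of n (index n u)) = periodic n x u"
proof (cases u)
  case (Up i j)
  have *: "nat (j mod int n) < n" "nat (i mod int n) < n"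
    using assms by (auto simp: nat_less_iff)
  show ?thesis using * assms by (simp add: Up cell_of_def div_mod_combine)
next
  case (Down i j)
  have *: "nat (j mod int n) < n" "nat (i mod int n) < n"
    using assms by (auto simp: nat_less_iff)
  have d: "(2 * (nat (i mod int n) * n + nat (j mod int n)) + 1) div 2 =
      nat (i mod int n) * n + nat (j mod int n)" by simp
  show ?thesis using * assms 
    unfolding cell_of_def Down index.simps d by (simp add: div_mod_combine)
qed

section \<open>Instances as bit strings\<close>

lemma concat_map_upt:
  assumes "n > 0"
  shows "concat (map (\<lambda>i. map (h i) [0..<n]) [0..<k]) = map (\<lambda>q. h (q div n) (q mod n)) [0..<k * n]"
proof (induction k)
  case (Suc k)
  have "[0..<Suc k * n] = [0..<k * n] @ map (\<lambda>j. k * n + j) [0..<n]"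
    using upt_add_eq_append[of 0 "k * n" n] by (simp add: map_add_upt add.commute)
  then show ?case using Suc assms by (simp add: o_def)
qed simp

lemma concat_concat: "concat (concat xss) = concat (map concat xss)"
  by (induction xss) simp_all

text \<open>The number of a cell is its position in the encoding: \<open>concat_map_upt\<close>
  flattens first the loops over \<open>i\<close> and \<open>j\<close>, then the choice between the
  two triangles of a rhombus.\<close>

lemma region_list_eq: "region_list n = map (cell_of n) [0..<2 * (n * n)]"
proof (cases "n = 0")
  case False
  have up: "[0..int n - 1] = map int [0..<n]"
    by (rule nth_equalityI) auto
  let ?h = "\<lambda>r s. (if s = 0 then Up else Down) (int (r div n)) (int (r mod n))"
  have "region_list n =
      concat (map (\<lambda>i. concat (map (\<lambda>j. [Up (int i) (int j), Down (int i) (int j)]) [0..<n])) [0..<n])"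
    unfolding region_list_def up by (simp add: o_def)
  also have "\<dots> = concat (concat (map (\<lambda>i. map (\<lambda>j. [Up (int i) (int j), Down (int i) (int j)]) [0..<n]) [0..<n]))"
    by (simp add: concat_concat o_def)
  also have "\<dots> = concat (map (\<lambda>r. map (?h r) [0..<2]) [0..<n * n])"
    using False by (subst concat_map_upt) (auto simp: upt_rec)
  also have "\<dots> = map (\<lambda>q. ?h (q div 2) (q mod 2)) [0..<n * n * 2]"
    by (subst concat_map_upt) auto
  also have "\<dots> = map (cell_of n) [0..<2 * (n * n)]"
    by (auto simp: cell_of_def mult.commute even_iff_mod_2_eq_zero)
  finally show ?thesis .
qed (simp add: region_list_def)

lemma length_region_list [simp]: "length (region_list n) = 2 * (n * n)"
  by (simp add: region_list_eq)

lemma length_encode: "length (encode n x u) = 4 * (n * n)"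
  by (simp add: encode_def)

lemma nth_encode:
  assumes "q < 2 * (n * n)"
  shows "encode n x u ! q = x (cell_of n q)"
    and "encode n x u ! (2 * (n * n) + q) \<longleftrightarrow> cell_of n q = u"
  using assms by (simp_all add: encode_def nth_append region_list_eq)

text \<open>Membership becomes a condition on the bits of \<open>w\<close>, with numbers
  \<open>n\<close> and \<open>q\<close> that processors can guess.\<close>

lemma Stability_iff:
  "w \<in> Stability I \<longleftrightarrow>
     (\<exists>n q. 1 \<le> n \<and> length w = 4 * (n * n) \<and> q < 2 * (n * n) \<and>
        (\<forall>v<2 * (n * n). w ! (2 * (n * n) + v) \<longleftrightarrow> v = q) \<and> \<not> w ! q \<and>
        stable I (\<lambda>u. w ! index n u) (cell_of n q))"
    (is "_ \<longleftrightarrow> (\<exists>n q. ?R n q)")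
proof
  assume "w \<in> Stability I"
  then obtain n x u where *: "w = encode n x u" "1 \<le> n" "u \<in> region n" "\<not> x u"
      "stable I (periodic n x) u"
    by (auto simp: Stability_def)
  from *(3) obtain q where q: "q < 2 * (n * n)" "u = cell_of n q"
    by (auto simp flip: set_region_list simp: region_list_eq)
  have "periodic n x = (\<lambda>u. w ! index n u)"
    using * index_less[of n] nth_encode(1) cell_of_index[of n x] by auto
  moreover have "cell_of n v = u \<longleftrightarrow> v = q" if "v < 2 * (n * n)" for v
    using that q index_cell_of by metis
  ultimately have "?R n q"
    using * q nth_encode length_encode by auto
  then show "\<exists>n q. ?R n q" by blast
next
  assume "\<exists>n q. ?R n q"
  then obtain n q where R: "?R n q" by blast
  \<comment> \<open>Reading the states off \<open>w\<close> through \<open>index\<close> yields a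
    configuration that is already periodic.\<close>
  define x where "x = (\<lambda>u. w ! index n u)"
  have "encode n x (cell_of n q) = w"
  proof (rule nth_equalityI)
    show "length (encode n x (cell_of n q)) = length w" using R by (simp add: length_encode)
    fix k assume "k < length (encode n x (cell_of n q))"
    then consider "k < 2 * (n * n)" | v where "k = 2 * (n * n) + v" "v < 2 * (n * n)"
      by (cases "k < 2 * (n * n)") (auto simp: length_encode not_less dest!: le_Suc_ex)
    then show "encode n x (cell_of n q) ! k = w ! k"
    proof cases
      case 1
      then show ?thesis by (simp add: nth_encode x_def index_cell_of)
    next
      case (2 v)
      have "cell_of n v = cell_of n q \<longleftrightarrow> v = q"
        using 2 R index_cell_of by metis
      with 2 R show ?thesis by (simp add: nth_encode)
    qed
  qed
  moreover have per: "periodic n x = x"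
  proof
    fix u
    have "periodic n x u = x (cell_of n (index n u))"
      using R cell_of_index[of n x u] by simp
    also have "\<dots> = x u"
      using R index_less[of n u] by (simp add: x_def index_cell_of)
    finally show "periodic n x u = x u" .
  qed
  moreover have "cell_of n q \<in> region n"
    using R by (simp flip: set_region_list add: region_list_eq)
  moreover have "\<not> x (cell_of n q)" "stable I (periodic n x) (cell_of n q)"
    unfolding per using R by (simp_all add: x_def index_cell_of)
  ultimately show "w \<in> Stability I"
    using R unfolding Stability_def by blast
qed

text \<open>The dart that leaves the cell with index \<open>q\<close> in direction \<open>d < 3\<close> is the number \<open>3 q + d\<close>.\<close>

definition dart_edges :: "bool list \<Rightarrow> nat \<Rightarrow> (nat \<times> nat) set" where
  "dart_edges w n =
     {(x, y). x < 6 * (n * n) \<and> y < 6 * (n * n) \<and> y mod 3 \<noteq> x mod 3 \<and>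
        y div 3 = nb_index n (x div 3) (x mod 3) \<and> \<not> w ! (y div 3)}"

lemma Domain_relpow_Suc:
  "x \<in> Domain (E ^^ Suc l) \<longleftrightarrow> (\<exists>y. (x, y) \<in> E \<and> y \<in> Domain (E ^^ l))"
  by (meson Domain_iff relpow_Suc_D2 relpow_Suc_I2)

text \<open>A dart holds the direction of the next step; an edge of the graph performs this step,
  checks that the cell reached is inactive and chooses a different direction for going on.\<close>

lemma walk_iff_relpow:
  assumes "n > 0" "d < 3"
  shows "walk (\<lambda>u. w ! index n u) l u d \<longleftrightarrow> 3 * index n u + d \<in> Domain (dart_edges w n ^^ l)"
  using assms(2)
proof (induction l arbitrary: u d)
  case (Suc l)
  let ?E = "dart_edges w n" and ?v = "nb u d"
  have edge: "(3 * index n u + d, y) \<in> ?E \<longleftrightarrow>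
      (\<exists>d'<3. d' \<noteq> d \<and> y = 3 * index n ?v + d' \<and> \<not> w ! index n ?v)" for y
  proof
    assume "(3 * index n u + d, y) \<in> ?E"
    with Suc.prems have "y mod 3 \<noteq> d" "y div 3 = index n ?v" "\<not> w ! index n ?v"
      by (auto simp: dart_edges_def index_nb[OF assms(1)])
    then show "\<exists>d'<3. d' \<noteq> d \<and> y = 3 * index n ?v + d' \<and> \<not> w ! index n ?v"
      using mult_div_mod_eq[of 3 y] by (intro exI[of _ "y mod 3"]) simp
  next
    assume "\<exists>d'<3. d' \<noteq> d \<and> y = 3 * index n ?v + d' \<and> \<not> w ! index n ?v"
    then obtain d' where "d' < 3" "d' \<noteq> d" "y = 3 * index n ?v + d'" "\<not> w ! index n ?v" by blast
    then show "(3 * index n u + d, y) \<in> ?E"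
      using Suc.prems index_less[OF assms(1), of u] index_less[OF assms(1), of ?v]
      by (auto simp: dart_edges_def index_nb[OF assms(1)])
  qed
  have "3 * index n u + d \<in> Domain (?E ^^ Suc l) \<longleftrightarrow>
      (\<exists>y. (3 * index n u + d, y) \<in> ?E \<and> y \<in> Domain (?E ^^ l))"
    by (rule Domain_relpow_Suc)
  then show ?case using Suc.IH by (auto simp: edge)
qed simp

text \<open>Every strict inclusion costs an element, so among the first \<open>N + 1\<close>
  inclusions one is an equality, and it persists by \<open>stay\<close>.\<close>

lemma decreasing_sets_stabilize:
  fixes f :: "nat \<Rightarrow> 'a set"
  assumes dec: "\<And>l. f (Suc l) \<subseteq> f l"
    and fin: "finite (f 0)" and card: "card (f 0) \<le> N"
    and stay: "\<And>l. f (Suc l) = f l \<Longrightarrow> f (Suc (Suc l)) = f (Suc l)"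
    and "N \<le> l"
  shows "f l = f N"
proof -
  have fin': "finite (f k)" for k
    by (induction k) (use fin dec finite_subset in blast)+
  have "\<exists>k\<le>N. f (Suc k) = f k"
  proof (rule ccontr)
    assume *: "\<not> ?thesis"
    have "card (f k) + k \<le> N" if "k \<le> Suc N" for k
      using that
    proof (induction k)
      case (Suc k)
      then have "f (Suc k) \<subset> f k" using dec * by fastforce
      then have "card (f (Suc k)) < card (f k)" using fin' psubset_card_mono by blast
      with Suc show ?case by simp
    qed (use card in simp)
    from this[of "Suc N"] show False by simp
  qed
  then obtain k where k: "k \<le> N" "f (Suc k) = f k" by blast
  have const: "f (Suc j) = f j" if "k \<le> j" for j
    using that by (induction j rule: dec_induct) (use k stay in auto)
  have "f j = f k" if "k \<le> j" for j
    using that by (induction j rule: dec_induct) (use const in auto)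
  with k \<open>N \<le> l\<close> show ?thesis by (metis le_trans)
qed

text \<open>The domain of \<open>E ^^ Suc l\<close> is the preimage of the domain of
  \<open>E ^^ l\<close>, so one repetition makes the sequence constant.\<close>

lemma Domain_relpow_stabilize:
  assumes E: "E \<subseteq> {..<N} \<times> {..<N::nat}" and "Suc N \<le> l"
  shows "Domain (E ^^ l) = Domain (E ^^ Suc N)"
proof -
  \<comment> \<open>The chain starts at exponent 1, as \<open>E ^^ 0\<close> is the identity on all
    numbers and has an infinite domain; this shifts the threshold to \<open>Suc N\<close>.\<close>
  let ?f = "\<lambda>l. Domain (E ^^ Suc l)"
  have step: "Domain (E ^^ Suc l) = E\<inverse> `` Domain (E ^^ l)" for l
    using Domain_relpow_Suc[of _ l E] by blast
  have dec: "?f (Suc l) \<subseteq> ?f l" for l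
    by (subst relpow.simps(2)) blast
  have sub: "?f 0 \<subseteq> {..<N}" using E by auto
  have stay: "?f (Suc (Suc l)) = ?f (Suc l)" if "?f (Suc l) = ?f l" for l
  proof -
    have "?f (Suc (Suc l)) = E\<inverse> `` ?f (Suc l)" by (rule step)
    also have "\<dots> = E\<inverse> `` ?f l" by (simp only: that)
    also have "\<dots> = ?f (Suc l)" by (rule step[symmetric])
    finally show ?thesis .
  qed
  have "finite (?f 0)" using sub by (rule finite_subset) simp
  moreover have "card (?f 0) \<le> N" using card_mono[OF _ sub] by simp
  moreover have "N \<le> l - 1" using assms(2) by simp
  ultimately have "?f (l - 1) = ?f N"
    using decreasing_sets_stabilize[of ?f N "l - 1"] dec stay by blast
  moreover have "Suc (l - 1) = l" using assms(2) by simp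
  ultimately show ?thesis by (simp only:)
qed

text \<open>From length \<open>6 * (n * n) + 1\<close> on the domains are constant, and this
  threshold is itself below \<open>B\<close>, so the lengths below \<open>B\<close> suffice.\<close>

lemma stable_iff_relpow:
  assumes n: "n > 0" and q: "q < 2 * (n * n)" and inactive: "\<not> w ! q" and B: "6 * (n * n) + 1 < B"
  shows "stable {2} (\<lambda>u. w ! index n u) (cell_of n q) \<longleftrightarrow>
    (\<forall>l<B. of_bool (3 * q \<in> Domain (dart_edges w n ^^ l)) +
       of_bool (3 * q + 1 \<in> Domain (dart_edges w n ^^ l)) +
       of_bool (3 * q + 2 \<in> Domain (dart_edges w n ^^ l)) \<noteq> (1::nat))"
    (is "_ \<longleftrightarrow> (\<forall>l<B. ?N l \<noteq> 1)")
proof -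
  let ?M = "6 * (n * n)"
  have "stable {2} (\<lambda>u. w ! index n u) (cell_of n q) \<longleftrightarrow> (\<forall>l. ?N l \<noteq> 1)"
    using inactive q walk_iff_relpow[OF n, of _ w _ "cell_of n q"]
    by (subst stable_2_iff) (simp_all add: index_cell_of)
  moreover have "?N l \<noteq> 1" if N: "\<forall>l<B. ?N l \<noteq> 1" for l
  proof (cases "l < B")
    case False
    have "dart_edges w n \<subseteq> {..<?M} \<times> {..<?M}" by (auto simp: dart_edges_def)
    then have "Domain (dart_edges w n ^^ l) = Domain (dart_edges w n ^^ Suc ?M)"
      using B False by (intro Domain_relpow_stabilize) simp_all
    moreover have "?N (Suc ?M) \<noteq> 1" using N B unfolding Suc_eq_plus1 by blast
    ultimately show ?thesis by (simp only: not_False_eq_True)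
  qed (use N in blast)
  ultimately show ?thesis by blast
qed

section \<open>Uniform execution of programs\<close>

fun exact :: "(nat \<Rightarrow> nat) \<Rightarrow> exp \<Rightarrow> nat" where
  "exact r (Const k) = k"
| "exact r (Reg k) = r k"
| "exact r (Plus d e) = exact r d + exact r e"
| "exact r (Minus d e) = exact r d - exact r e"
| "exact r (Times d e) = exact r d * exact r e"
| "exact r (Div d e) = exact r d div exact r e"
| "exact r (Mod d e) = exact r d mod exact r e"
| "exact r (Equal d e) = of_bool (exact r d = exact r e)"
| "exact r (Less d e) = of_bool (exact r d < exact r e)"

text \<open>
  If all registers are less than \<open>m ^ K\<close>, then all values that occur in the evaluation of \<open>e\<close>
  are less than \<open>m ^ expo K e\<close>, so there is no overflow for large enough words.
\<close>

fun expo :: "nat \<Rightarrow> exp \<Rightarrow> nat" where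
  "expo K (Const k) = k"
| "expo K (Reg k) = K"
| "expo K (Plus d e) = Suc (max (expo K d) (expo K e))"
| "expo K (Minus d e) = max (expo K d) (expo K e)"
| "expo K (Times d e) = expo K d + expo K e"
| "expo K (Div d e) = max (expo K d) (expo K e)"
| "expo K (Mod d e) = max (expo K d) (expo K e)"
| "expo K (Equal d e) = Suc (max (expo K d) (expo K e))"
| "expo K (Less d e) = Suc (max (expo K d) (expo K e))"

lemma of_bool_less_power:
  assumes "(2::nat) \<le> m"
  shows "of_bool P < m ^ Suc k"
proof -
  have "m ^ 1 \<le> m ^ Suc k" using assms by (intro power_increasing) auto
  then have "2 \<le> m ^ Suc k" using assms by (simp del: power_Suc)
  then show ?thesis using assms by (cases P) (simp_all del: power_Suc)
qed

text \<open>The exponent of an expression dominates those of its parts, so if it is at most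
  \<open>b\<close>, no intermediate value reaches \<open>W\<close> and reduction modulo
  \<open>W\<close> has no effect.\<close>

lemma eval_exact:
  assumes m: "2 \<le> m" and W: "m ^ b \<le> W" and r: "\<And>k. r k < m ^ K"
  shows "expo K e \<le> b \<Longrightarrow> eval W r e = exact r e \<and> exact r e < m ^ expo K e"
proof (induction e)
  case (Const k)
  have "k < 2 ^ k" by (rule less_exp)
  also have "\<dots> \<le> m ^ k" using m by (intro power_mono) auto
  finally have "k < m ^ k" .
  moreover have "m ^ k \<le> m ^ b" using Const m by (intro power_increasing) auto
  ultimately show ?case using W by simp
next
  case (Reg k)
  then show ?case using r by simp
next
  case (Plus d e)
  let ?M = "max (expo K d) (expo K e)"
  have "m ^ expo K d \<le> m ^ ?M" "m ^ expo K e \<le> m ^ ?M"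
    using m by (auto intro!: power_increasing)
  moreover have "exact r d < m ^ expo K d" "exact r e < m ^ expo K e" using Plus by simp_all
  ultimately have "exact r d + exact r e < 2 * m ^ ?M" by linarith
  also have "\<dots> \<le> m ^ Suc ?M" using m by simp
  finally have *: "exact r d + exact r e < m ^ Suc ?M" .
  moreover have "m ^ Suc ?M \<le> m ^ b" using Plus.prems m by (intro power_increasing) auto
  ultimately have "exact r d + exact r e < W" using W by linarith
  with * show ?case using Plus by simp
next
  case (Minus d e)
  have "m ^ expo K d \<le> m ^ max (expo K d) (expo K e)"
    using m by (intro power_increasing) auto
  then have "exact r d - exact r e < m ^ max (expo K d) (expo K e)"
    using Minus by (simp add: less_imp_diff_less)
  then show ?case using Minus by simp
next
  case (Times d e)
  have *: "exact r d * exact r e < m ^ (expo K d + expo K e)"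
    unfolding power_add using Times by (intro mult_strict_mono') auto
  moreover have "m ^ (expo K d + expo K e) \<le> m ^ b"
    using Times.prems m by (intro power_increasing) auto
  ultimately have "exact r d * exact r e < W" using W by linarith
  with * show ?case using Times by simp
next
  case (Div d e)
  have "exact r d div exact r e \<le> exact r d" by simp
  also have "\<dots> < m ^ expo K d" using Div by simp
  also have "\<dots> \<le> m ^ max (expo K d) (expo K e)" using m by (intro power_increasing) auto
  finally show ?case using Div by simp
next
  case (Mod d e)
  have "exact r d mod exact r e \<le> exact r d" by simp
  also have "\<dots> < m ^ expo K d" using Mod by simp
  also have "\<dots> \<le> m ^ max (expo K d) (expo K e)" using m by (intro power_increasing) auto
  finally show ?case using Mod by simp
next
  case (Equal d e)
  then show ?case using of_bool_less_power[OF m] by (simp del: power_Suc)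
next
  case (Less d e)
  then show ?case using of_bool_less_power[OF m] by (simp del: power_Suc)
qed

fun instr_expo :: "nat \<Rightarrow> instr \<Rightarrow> nat" where
  "instr_expo K (Assign k e) = expo K e"
| "instr_expo K (Read k e) = expo K e"
| "instr_expo K (Write d e) = max (expo K d) (expo K e)"
| "instr_expo K (Branch e l) = expo K e"

locale simd =
  fixes P :: "instr list" and w :: "bool list" and W p K b :: nat
  assumes instr_expo_le: "ins \<in> set P \<Longrightarrow> instr_expo K ins \<le> b"
    and words: "(length w + 2) ^ b \<le> W"
    and procs: "p \<le> (length w + 2) ^ K"
    and K_pos: "0 < K"
begin

abbreviation bound :: nat where "bound \<equiv> (length w + 2) ^ K"

definition run :: "nat \<Rightarrow> pram" where
  "run t = (pram_step W p P ^^ t) (pram_init w)"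

text \<open>
  All processors are at the same instruction, and as only 0 and 1 are ever stored, the memory
  is given by the set \<open>A\<close> of the addresses that contain 1.
\<close>

definition state :: "nat \<Rightarrow> nat \<Rightarrow> (nat \<Rightarrow> (nat \<Rightarrow> nat) \<Rightarrow> bool) \<Rightarrow> nat set \<Rightarrow> bool" where
  "state t q C A \<longleftrightarrow>
     (\<forall>i<p. pc (run t) i = q \<and> (\<forall>k. regs (run t) i k < bound) \<and> C i (regs (run t) i)) \<and>
     mem (run t) = (\<lambda>a. of_bool (a \<in> A))"

lemma run_Suc: "run (Suc t) = pram_step W p P (run t)"
  by (simp add: run_def)

lemma length_less_bound: "length w + 1 < bound"
proof -
  have "(length w + 2) ^ 1 \<le> bound" using K_pos by (intro power_increasing) auto
  then show ?thesis by simp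
qed

lemma eval_regs:
  assumes "state t q C A" "i < p" "expo K e \<le> b"
  shows "eval W (regs (run t) i) e = exact (regs (run t) i) e"
  using assms eval_exact[of "length w + 2" b W "regs (run t) i" K e] words
  by (simp add: state_def)

lemma state_fetch:
  assumes "state t q C A" "q < length P" "i < p"
  shows "fetch P (run t) i = Some (P ! q)"
  using assms by (simp add: state_def fetch_def)

lemma no_write:
  assumes "\<And>i. i < p \<Longrightarrow> write_request W P s i = None"
  shows "next_mem W p P s = mem s"
  using assms by (auto simp: next_mem_def Let_def fun_eq_iff)

section \<open>Rules for the effect of single instructions\<close>

lemma state_init:
  "state 0 0 (\<lambda>i r. r 0 = i \<and> r 1 = length w) {a. a < length w \<and> w ! a}"
  using procs length_less_bound K_pos
  by (auto simp: state_def run_def pram_init_def fun_eq_iff)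

lemma state_assign:
  assumes state: "state t q C A" and q: "q < length P" and ins: "P ! q = Assign k e" and q': "q' = Suc q"
    and C': "\<And>i r. i < p \<Longrightarrow> C i r \<Longrightarrow> exact r e < bound \<and> C' i (r(k := exact r e))"
  shows "state (Suc t) q' C' A"
proof -
  have "expo K e \<le> b" using instr_expo_le[of "P ! q"] nth_mem[OF q] ins by simp
  note ev = eval_regs[OF state _ this]
  show ?thesis
    using state C' state_fetch[OF state q] ev
    by (auto simp: state_def run_Suc pram_step_def next_pc_def next_regs_def ins q' no_write
        write_request_def)
qed

lemma state_read:
  assumes state: "state t q C A" and q: "q < length P" and ins: "P ! q = Read k e" and q': "q' = Suc q"
    and C': "\<And>i r. i < p \<Longrightarrow> C i r \<Longrightarrow> C' i (r(k := of_bool (exact r e \<in> A)))"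
  shows "state (Suc t) q' C' A"
proof -
  have "expo K e \<le> b" using instr_expo_le[of "P ! q"] nth_mem[OF q] ins by simp
  note ev = eval_regs[OF state _ this]
  have "of_bool Q < bound" for Q using length_less_bound by (cases Q) auto
  then show ?thesis
    using state C' state_fetch[OF state q] ev
    by (auto simp: state_def run_Suc pram_step_def next_pc_def next_regs_def ins q' no_write
        write_request_def)
qed

text \<open>The test has the same outcome for all processors, so they stay in lockstep.\<close>

lemma state_branch:
  assumes state: "state t q C A" and q: "q < length P" and ins: "P ! q = Branch e l" and q': "q' = Suc q"
    and jump: "\<And>i r. i < p \<Longrightarrow> C i r \<Longrightarrow> exact r e \<noteq> 0 \<longleftrightarrow> jump"
  shows "state (Suc t) (if jump then l else q') C A"
proof -
  have "expo K e \<le> b" using instr_expo_le[of "P ! q"] nth_mem[OF q] ins by simp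
  note ev = eval_regs[OF state _ this]
  show ?thesis
    using state jump state_fetch[OF state q] ev
    by (auto simp: state_def run_Suc pram_step_def next_pc_def next_regs_def ins q' no_write
        write_request_def)
qed

text \<open>All writers store the same value \<open>v\<close>, so it does not matter which of them
  wins a conflict.\<close>

lemma state_write:
  assumes state: "state t q C A" and q: "q < length P" and ins: "P ! q = Write d e" and q': "q' = Suc q"
    and exact: "\<And>i r. i < p \<Longrightarrow> C i r \<Longrightarrow> exact r d = \<alpha> i \<and> exact r e = of_bool v"
  shows "state (Suc t) q' C (if v then A \<union> \<alpha> ` {..<p} else A - \<alpha> ` {..<p})"
proof -
  have b: "expo K d \<le> b" "expo K e \<le> b" using instr_expo_le[of "P ! q"] nth_mem[OF q] ins by simp_all
  have req: "write_request W P (run t) i = Some (\<alpha> i, of_bool v)" if "i < p" for i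
    using that state exact state_fetch[OF state q] eval_regs[OF state _ b(1)] eval_regs[OF state _ b(2)]
    by (simp add: write_request_def ins state_def)
  have "next_mem W p P (run t) a = (if a \<in> \<alpha> ` {..<p} then of_bool v else mem (run t) a)" for a
  proof (cases "a \<in> \<alpha> ` {..<p}")
    case True
    let ?w = "\<lambda>i. i < p \<and> (\<exists>v. write_request W P (run t) i = Some (a, v))"
    from True obtain i where "?w i" using req by auto
    then have "?w (Least ?w)" by (rule LeastI)
    then have "snd (the (write_request W P (run t) (Least ?w))) = of_bool v" using req by auto
    with True \<open>?w i\<close> show ?thesis by (auto simp: next_mem_def Let_def)
  next
    case False
    then show ?thesis using req by (auto simp: next_mem_def Let_def)
  qed
  then show ?thesis
    using state state_fetch[OF state q]
    by (auto simp: state_def run_Suc pram_step_def next_pc_def next_regs_def ins q' fun_eq_iff)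
qed

end

text \<open>
  Processors for which \<open>c\<close> is 0 are diverted to the dummy address \<open>length w\<close>; a write of 1
  has no effect there, as this cell is set to 1 at the beginning.
\<close>

definition select :: "exp \<Rightarrow> exp \<Rightarrow> exp" where
  "select c e = Plus (Times c e) (Times (Minus (Const 1) c) (Reg 1))"

lemma (in simd) state_select_write:
  assumes state: "state t q C A" and q: "q < length P" and ins: "P ! q = Write (select c e) (Const 1)" and q': "q' = Suc q"
    and sel: "\<And>i r. i < p \<Longrightarrow> C i r \<Longrightarrow>
      r 1 = length w \<and> exact r c = of_bool (\<gamma> i) \<and> (\<gamma> i \<longrightarrow> exact r e = \<alpha> i)"
    and dummy: "length w \<in> A"
  shows "state (Suc t) q' C (A \<union> {\<alpha> i |i. i < p \<and> \<gamma> i})"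
proof -
  let ?\<alpha> = "\<lambda>i. if \<gamma> i then \<alpha> i else length w"
  have "state (Suc t) q' C (if True then A \<union> ?\<alpha> ` {..<p} else A - ?\<alpha> ` {..<p})"
  proof (rule state_write[OF state q ins q'])
    fix i r assume "i < p" "C i r"
    from sel[OF this] show "exact r (select c e) = ?\<alpha> i \<and> exact r (Const 1) = of_bool True"
      by (auto simp: select_def)
  qed
  moreover have "A \<union> ?\<alpha> ` {..<p} = A \<union> {\<alpha> i |i. i < p \<and> \<gamma> i}"
    using dummy by auto
  ultimately show ?thesis by simp
qed

section \<open>A program for the stability problem\<close>

text \<open>For inputs of length \<open>4 * (n * n)\<close> the base exceeds the number of darts and
  the relevant walk lengths (see \<open>side_bound\<close>), so each of them fits into one
  digit.\<close>

definition base_exp :: exp where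
  "base_exp = Times (Plus (Reg 1) (Const 2)) (Plus (Reg 1) (Const 2))"

fun power_exp :: "nat \<Rightarrow> exp" where
  "power_exp 0 = Const 1"
| "power_exp (Suc k) = Times base_exp (power_exp k)"

definition digit :: "nat \<Rightarrow> exp" where
  "digit k = Mod (Div (Reg 0) (power_exp k)) base_exp"

text \<open>Addresses up to the input length plus 2 belong to the input, the dummy and the two
  flags; the table follows as a block of three-digit numbers.\<close>

definition table_exp :: "exp \<Rightarrow> exp \<Rightarrow> exp \<Rightarrow> exp" where
  "table_exp x y l = Plus (Plus (Reg 1) (Const 3)) (Plus (Times (Plus (Times x base_exp) y) base_exp) l)"

text \<open>The second table begins right behind the \<open>B ^ 3\<close> addresses of the first,
  where \<open>B\<close> is the base.\<close>

definition domain_exp :: "exp \<Rightarrow> exp \<Rightarrow> exp" where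
  "domain_exp x l = Plus (Plus (Reg 1) (Const 3)) (Plus (power_exp 3) (Plus (Times x base_exp) l))"

definition not_exp :: "exp \<Rightarrow> exp" where
  "not_exp c = Minus (Const 1) c"

definition or_exp :: "exp \<Rightarrow> exp \<Rightarrow> exp" where
  "or_exp c d = Less (Const 0) (Plus c d)"

definition side_exp :: exp where
  "side_exp = Times (Equal (Reg 1) (Times (Const 4) (Times (digit 0) (digit 0)))) (Less (Const 0) (digit 0))"

definition half_exp :: exp where
  "half_exp = Times (Const 2) (Times (digit 0) (digit 0))"

definition nb_exp :: "exp \<Rightarrow> exp \<Rightarrow> exp \<Rightarrow> exp" where
  "nb_exp n q d =
     (let s = Mod q (Const 2); i = Div (Div q (Const 2)) n; j = Mod (Div q (Const 2)) n;
          k = Plus (Times (Minus (Const 1) s) (Minus n (Const 1))) s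
      in Plus (Times (Const 2)
           (Plus (Times (Mod (Plus i (Times (Equal d (Const 1)) k)) n) n)
                 (Mod (Plus j (Times (Equal d (Const 2)) k)) n)))
         (Minus (Const 1) s))"

text \<open>Test for membership in \<open>dart_edges\<close>, with the state of the target cell in
  register 3.\<close>

definition edge_exp :: exp where
  "edge_exp =
     (let x = digit 1; y = digit 2; darts = Times (Const 3) half_exp in
      Times side_exp (Times (Less x darts) (Times (Less y darts)
        (Times (not_exp (Equal (Mod y (Const 3)) (Mod x (Const 3))))
        (Times (Equal (Div y (Const 3)) (nb_exp (digit 0) (Div x (Const 3)) (Mod x (Const 3))))
          (not_exp (Reg 3)))))))"

definition marked_exp :: exp where
  "marked_exp = Times side_exp (Times (Less (digit 1) half_exp) (Reg 3))"

text \<open>The marked cell \<open>digit 1\<close> is refuted by another marked cell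
  \<open>digit 2\<close>, by being active itself, or by having walks of length
  \<open>digit 4\<close> in exactly one direction. Registers 4 to 8 hold the bits read for these
  tests.\<close>

definition refuted_exp :: exp where
  "refuted_exp =
     or_exp (Times (Less (digit 2) half_exp) (Times (Reg 4) (not_exp (Equal (digit 2) (digit 1)))))
       (or_exp (Reg 5) (Equal (Plus (Plus (Reg 6) (Reg 7)) (Reg 8)) (Const 1)))"

text \<open>
  The digits of the processor number in base \<open>(length w + 2)\<^sup>2\<close> stand for
  \<open>(n, x, y, z, l\<^sub>1, l\<^sub>2)\<close>, where \<open>n\<close> is a guess of the dimension, \<open>x\<close>, \<open>y\<close>, \<open>z\<close> are darts (in the
  last phase \<open>x\<close> and \<open>y\<close> are cells) and \<open>l\<^sub>1\<close>, \<open>l\<^sub>2\<close> are lengths of walks.  The table records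
  whether a walk of length \<open>l\<close> leads from \<open>x\<close> to \<open>y\<close>; its valid lengths double in each round of
  the loop.  The flags at \<open>length w + 1\<close> and \<open>length w + 2\<close> say that some cell is marked
  and that a marked cell violates one of the conditions for acceptance.
\<close>

definition program :: "instr list" where
  "program =
    [Write (Reg 1) (Const 1),
     Read 3 (Div (digit 2) (Const 3)),
     Write (select edge_exp (table_exp (digit 1) (digit 2) (Const 1))) (Const 1),
     Assign 2 (Const 1),
     Read 3 (table_exp (digit 1) (digit 3) (digit 4)),
     Read 4 (table_exp (digit 3) (digit 2) (digit 5)),
     Write (select (Times (Times (Reg 3) (Reg 4)) (Less (Plus (digit 4) (digit 5)) base_exp))
       (table_exp (digit 1) (digit 2) (Plus (digit 4) (digit 5)))) (Const 1),
     Assign 2 (Times (Const 2) (Reg 2)),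
     Branch (Less (Reg 2) base_exp) 4,
     Read 3 (table_exp (digit 1) (digit 2) (digit 4)),
     Write (select (Reg 3) (domain_exp (digit 1) (digit 4))) (Const 1),
     Read 3 (Plus half_exp (digit 1)),
     Read 4 (Plus half_exp (digit 2)),
     Read 5 (digit 1),
     Read 6 (domain_exp (Times (Const 3) (digit 1)) (digit 4)),
     Read 7 (domain_exp (Plus (Times (Const 3) (digit 1)) (Const 1)) (digit 4)),
     Read 8 (domain_exp (Plus (Times (Const 3) (digit 1)) (Const 2)) (digit 4)),
     Write (select marked_exp (Plus (Reg 1) (Const 1))) (Const 1),
     Write (select (Times marked_exp refuted_exp) (Plus (Reg 1) (Const 2))) (Const 1),
     Read 3 (Plus (Reg 1) (Const 1)),
     Read 4 (Plus (Reg 1) (Const 2)),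
     Write (Const 0) (Times (Reg 3) (not_exp (Reg 4)))]"

lemma length_program: "length program = 22"
  by (simp add: program_def)

context
  notes One_nat_def [simp del]
begin

text \<open>Fact number \<open>k\<close> of this list gives the instruction at address
  \<open>k - 1\<close>.\<close>

lemmas program_nth = arg_cong[OF program_def, where f = "\<lambda>P. P ! 0", simplified]
  arg_cong[OF program_def, where f = "\<lambda>P. P ! 1", simplified]
  arg_cong[OF program_def, where f = "\<lambda>P. P ! 2", simplified]
  arg_cong[OF program_def, where f = "\<lambda>P. P ! 3", simplified]
  arg_cong[OF program_def, where f = "\<lambda>P. P ! 4", simplified]
  arg_cong[OF program_def, where f = "\<lambda>P. P ! 5", simplified]
  arg_cong[OF program_def, where f = "\<lambda>P. P ! 6", simplified]
  arg_cong[OF program_def, where f = "\<lambda>P. P ! 7", simplified]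
  arg_cong[OF program_def, where f = "\<lambda>P. P ! 8", simplified]
  arg_cong[OF program_def, where f = "\<lambda>P. P ! 9", simplified]
  arg_cong[OF program_def, where f = "\<lambda>P. P ! 10", simplified]
  arg_cong[OF program_def, where f = "\<lambda>P. P ! 11", simplified]
  arg_cong[OF program_def, where f = "\<lambda>P. P ! 12", simplified]
  arg_cong[OF program_def, where f = "\<lambda>P. P ! 13", simplified]
  arg_cong[OF program_def, where f = "\<lambda>P. P ! 14", simplified]
  arg_cong[OF program_def, where f = "\<lambda>P. P ! 15", simplified]
  arg_cong[OF program_def, where f = "\<lambda>P. P ! 16", simplified]
  arg_cong[OF program_def, where f = "\<lambda>P. P ! 17", simplified]
  arg_cong[OF program_def, where f = "\<lambda>P. P ! 18", simplified]
  arg_cong[OF program_def, where f = "\<lambda>P. P ! 19", simplified]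
  arg_cong[OF program_def, where f = "\<lambda>P. P ! 20", simplified]
  arg_cong[OF program_def, where f = "\<lambda>P. P ! 21", simplified]

end

text \<open>Appending a least digit in each induction step realizes any digits; hence every
  combination of guesses has its processor.\<close>

lemma digits_exist:
  fixes B :: nat
  assumes "\<And>k. k < N \<Longrightarrow> f k < B"
  shows "\<exists>i<B ^ N. \<forall>k<N. i div B ^ k mod B = f k"
  using assms
proof (induction N arbitrary: f)
  case (Suc N)
  from Suc.IH[of "f \<circ> Suc"] Suc.prems obtain i
    where i: "i < B ^ N" "\<forall>k<N. i div B ^ k mod B = f (Suc k)" by auto
  have f0: "f 0 < B" using Suc.prems by simp
  let ?i = "i * B + f 0"
  have "?i < B ^ N * B" by (rule combine_less[OF i(1) f0])
  moreover have "?i div B ^ k mod B = f k" if k: "k < Suc N" for k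
  proof (cases k)
    case (Suc j)
    have "?i div B ^ k = i div B ^ j"
      using div_mod_combine(1)[OF f0, of i] by (simp add: Suc div_mult2_eq)
    with i(2) k Suc show ?thesis by simp
  qed (use div_mod_combine(2)[OF f0, of i] in simp)
  ultimately show ?case by (auto simp: mult.commute)
qed simp

lemma combine_eq_iff:
  fixes a b n :: nat
  assumes "b < n" "b' < n"
  shows "a * n + b = a' * n + b' \<longleftrightarrow> a = a' \<and> b = b'"
  using div_mod_combine[OF assms(1), of a] div_mod_combine[OF assms(2), of a'] by metis

lemma of_bool_arith:
  "of_bool a * of_bool b = (of_bool (a \<and> b) :: nat)"
  "Suc 0 - of_bool a = (of_bool (\<not> a) :: nat)"
  "0 < of_bool a + (of_bool b :: nat) \<longleftrightarrow> a \<or> b"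
  by simp_all

lemma exact_nb: "exact r (nb_exp n q d) = nb_index (exact r n) (exact r q) (exact r d)"
  by (simp add: nb_exp_def nb_index_def Let_def)

text \<open>Six digits in base \<open>(length w + 2) ^ 2\<close> account for the exponent
  12.\<close>

locale stability_run = simd program w W p 12 b for w W p b +
  assumes p_eq: "p = (length w + 2) ^ 12"
begin

abbreviation L where "L \<equiv> length w"

definition B where "B = (L + 2) * (L + 2)"

definition dg where "dg k i = i div B ^ k mod B"

definition tab where "tab x y l = L + 3 + ((x * B + y) * B + l)"

definition dom where "dom x l = L + 3 + (B ^ 3 + (x * B + l))"

definition side where "side n \<longleftrightarrow> L = 4 * (n * n) \<and> 1 \<le> n"

lemma B_pos: "0 < B" and B_gt_1: "1 < B" and B_gt_2: "2 < B"
  by (simp_all add: B_def)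

lemma dg_less [simp]: "dg k i < B"
  using B_pos by (simp add: dg_def)

lemma p_eq_B: "p = B ^ 6"
  unfolding p_eq B_def by (simp only: power2_eq_square[symmetric] power_mult[symmetric]) simp

lemma p_pos: "0 < p"
  using B_pos by (simp add: p_eq_B)

lemma ex_digits:
  assumes "a0 < B" "a1 < B" "a2 < B" "a3 < B" "a4 < B" "a5 < B"
  obtains i where "i < p" "dg 0 i = a0" "dg 1 i = a1" "dg 2 i = a2" "dg 3 i = a3" "dg 4 i = a4" "dg 5 i = a5"
proof -
  let ?as = "[a0, a1, a2, a3, a4, a5]"
  have "?as ! k < B" if "k < 6" for k
    using that assms by (auto simp: less_Suc_eq numeral_eq_Suc)
  then obtain i where i: "i < B ^ 6" "\<And>k. k < 6 \<Longrightarrow> dg k i = ?as ! k"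
    using digits_exist[of 6 "\<lambda>k. ?as ! k"] unfolding dg_def by blast
  show ?thesis
    using i(1) i(2)[of 0] i(2)[of 1] i(2)[of 2] i(2)[of 3] i(2)[of 4] i(2)[of 5]
    by (intro that[of i]) (simp_all add: p_eq_B)
qed

lemma side_bound:
  assumes "side n"
  shows "6 * (n * n) + 1 < B" "n < B"
proof -
  \<comment> \<open>The left-hand side is \<open>8 * (n * n) + 4\<close>.\<close>
  have "(L + 2) * 2 \<le> B" unfolding B_def by (intro mult_le_mono2) simp
  moreover have "n < n * n + 1" by (simp add: less_Suc_eq_le)
  moreover have "L = 4 * (n * n)" using assms by (simp add: side_def)
  ultimately show "6 * (n * n) + 1 < B" "n < B" by simp_all
qed

section \<open>Values of the expressions in the program\<close>

lemma exact_base: "r 1 = L \<Longrightarrow> exact r base_exp = B"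
  by (simp add: base_exp_def B_def)

lemma exact_power: "r 1 = L \<Longrightarrow> exact r (power_exp k) = B ^ k"
  by (induction k) (simp_all add: exact_base)

lemma exact_digit: "r 1 = L \<Longrightarrow> exact r (digit k) = dg k (r 0)"
  by (simp add: digit_def dg_def exact_base exact_power)

lemma exact_table:
  "r 1 = L \<Longrightarrow> exact r (table_exp x y l) = tab (exact r x) (exact r y) (exact r l)"
  by (simp add: table_exp_def tab_def exact_base)

lemma exact_domain:
  "r 1 = L \<Longrightarrow> exact r (domain_exp x l) = dom (exact r x) (exact r l)"
  by (simp add: domain_exp_def dom_def exact_base exact_power)

lemma exact_side: "r 1 = L \<Longrightarrow> exact r side_exp = of_bool (side (dg 0 (r 0)))"
  by (simp add: side_exp_def side_def exact_digit Suc_le_eq flip: of_bool_conj)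

lemma exact_half: "r 1 = L \<Longrightarrow> exact r half_exp = 2 * (dg 0 (r 0) * dg 0 (r 0))"
  by (simp add: half_exp_def exact_digit)

lemma exact_edge:
  assumes "r 1 = L" "r 3 = of_bool Q" "r 0 = i"
  shows "exact r edge_exp = of_bool (side (dg 0 i) \<and> dg 1 i < 6 * (dg 0 i * dg 0 i) \<and>
    dg 2 i < 6 * (dg 0 i * dg 0 i) \<and> dg 2 i mod 3 \<noteq> dg 1 i mod 3 \<and>
    dg 2 i div 3 = nb_index (dg 0 i) (dg 1 i div 3) (dg 1 i mod 3) \<and> \<not> Q)"
  using assms
  by (simp add: edge_exp_def Let_def exact_side exact_half exact_digit exact_nb not_exp_def
      of_bool_arith del: of_bool_conj)

lemma exact_marked:
  assumes "r 1 = L" "r 3 = of_bool Q" "r 0 = i"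
  shows "exact r marked_exp = of_bool (side (dg 0 i) \<and> dg 1 i < 2 * (dg 0 i * dg 0 i) \<and> Q)"
  using assms
  by (simp add: marked_exp_def exact_side exact_half exact_digit of_bool_arith del: of_bool_conj)

lemma exact_refuted:
  assumes "r 1 = L" "r 0 = i" "r 4 = of_bool Q4" "r 5 = of_bool Q5"
    "r 6 = of_bool Q6" "r 7 = of_bool Q7" "r 8 = of_bool Q8"
  shows "exact r refuted_exp = of_bool (dg 2 i < 2 * (dg 0 i * dg 0 i) \<and> Q4 \<and> dg 2 i \<noteq> dg 1 i \<or>
    Q5 \<or> of_bool Q6 + of_bool Q7 + of_bool Q8 = (1::nat))"
  using assms
  by (simp add: refuted_exp_def or_exp_def not_exp_def exact_half exact_digit of_bool_arith
      del: of_bool_conj add_gr_0)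

section \<open>Layout of the shared memory\<close>

definition input :: "nat set" where
  "input = {a. a < L \<and> w ! a}"

definition Table :: "(nat \<Rightarrow> nat \<Rightarrow> nat \<Rightarrow> bool) \<Rightarrow> nat set" where
  "Table R = {tab x y l |x y l. x < B \<and> y < B \<and> l < B \<and> R x y l}"

definition Dom :: "(nat \<Rightarrow> nat \<Rightarrow> bool) \<Rightarrow> nat set" where
  "Dom S = {dom x l |x l. x < B \<and> l < B \<and> S x l}"

lemma Table_cong:
  assumes "\<And>x y l. l < B \<Longrightarrow> R x y l \<longleftrightarrow> R' x y l"
  shows "Table R = Table R'"
  unfolding Table_def using assms by (intro Collect_cong ex_cong1) auto

lemma tab_eq_iff:
  assumes "y < B" "l < B" "y' < B" "l' < B"
  shows "tab x y l = tab x' y' l' \<longleftrightarrow> x = x' \<and> y = y' \<and> l = l'"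
  using assms by (simp add: tab_def combine_eq_iff)

lemma dom_eq_iff:
  assumes "l < B" "l' < B"
  shows "dom x l = dom x' l' \<longleftrightarrow> x = x' \<and> l = l'"
  using assms by (simp add: dom_def combine_eq_iff)

text \<open>Three digits give a number below \<open>B ^ 3\<close>, so the first table meets neither
  the flags below it nor the second table above it.\<close>

lemma tab_bounds:
  assumes "x < B" "y < B" "l < B"
  shows "L + 2 < tab x y l" "tab x y l < L + 3 + B ^ 3"
proof -
  have "x * B + y < B * B" using assms by (intro combine_less)
  then have "(x * B + y) * B + l < B * B * B" using assms by (intro combine_less)
  then show "L + 2 < tab x y l" "tab x y l < L + 3 + B ^ 3"
    by (simp_all add: tab_def power3_eq_cube)
qed

lemma dom_bound: "L + 3 + B ^ 3 \<le> dom x l"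
  by (simp add: dom_def)

lemma tab_in_Table:
  assumes "x < B" "y < B" "l < B"
  shows "tab x y l \<in> Table R \<longleftrightarrow> R x y l"
  using assms by (auto simp: Table_def tab_eq_iff)

lemma dom_in_Dom:
  assumes "x < B" "l < B"
  shows "dom x l \<in> Dom S \<longleftrightarrow> S x l"
  using assms by (auto simp: Dom_def dom_eq_iff)

lemma not_in_tables:
  assumes "a \<le> L + 2"
  shows "a \<notin> Table R" "a \<notin> Dom S"
proof -
  show "a \<notin> Table R"
  proof
    assume "a \<in> Table R"
    then obtain x y l where "x < B" "y < B" "l < B" "a = tab x y l" by (auto simp: Table_def)
    with tab_bounds(1) assms show False by fastforce
  qed
  show "a \<notin> Dom S" using assms by (auto simp: Dom_def dom_def)
qed

lemma dom_not_in_Table: "dom x l \<notin> Table R"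
proof
  assume "dom x l \<in> Table R"
  then obtain x' y' l' where "x' < B" "y' < B" "l' < B" "dom x l = tab x' y' l'"
    by (auto simp: Table_def)
  with tab_bounds(2)[of x' y' l'] dom_bound[of x l] show False by simp
qed

lemma not_in_input: "L \<le> a \<Longrightarrow> a \<notin> input"
  by (simp add: input_def)

text \<open>The length of the input admits at most one dimension, so this union over all guesses is
  the dart graph for that dimension, or empty.\<close>

definition edges :: "(nat \<times> nat) set" where
  "edges = {(x, y). \<exists>n. side n \<and> (x, y) \<in> dart_edges w n}"

lemma edges_bound: "(x, y) \<in> edges \<Longrightarrow> x < B \<and> y < B"
proof -
  assume "(x, y) \<in> edges"
  then obtain n where "side n" "x < 6 * (n * n)" "y < 6 * (n * n)"
    by (auto simp: edges_def dart_edges_def)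
  with side_bound(1)[of n] show "x < B \<and> y < B" by simp
qed

section \<open>Walks of length 1 and the doubling loop\<close>

abbreviation idle :: "nat \<Rightarrow> (nat \<Rightarrow> nat) \<Rightarrow> bool" where
  "idle i r \<equiv> r 0 = i \<and> r 1 = L"

lemma state_weaken:
  assumes "state t q C A" "\<And>i r. i < p \<Longrightarrow> C i r \<Longrightarrow> C' i r" "A = A'"
  shows "state t q C' A'"
  using assms by (simp add: state_def)

lemma after_dummy: "state 1 1 idle (insert L input)"
proof -
  have "state (Suc 0) 1 idle (if True then input \<union> (\<lambda>i. L) ` {..<p} else input - (\<lambda>i. L) ` {..<p})"
    by (rule state_write[OF state_init[folded input_def] _ program_nth(1)])
      (simp_all add: length_program)
  then show ?thesis using p_pos by (simp add: image_constant_conv lessThan_empty_iff)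
qed

lemma after_edges: "state 3 3 idle (insert L input \<union> Table (\<lambda>x y l. l = 1 \<and> (x, y) \<in> edges))"
proof -
  let ?A = "insert L input"
  let ?C = "\<lambda>i r. idle i r \<and> r 3 = of_bool (dg 2 i div 3 \<in> ?A)"
  let ?\<gamma> = "\<lambda>i. side (dg 0 i) \<and> (dg 1 i, dg 2 i) \<in> dart_edges w (dg 0 i)"
  let ?\<alpha> = "\<lambda>i. tab (dg 1 i) (dg 2 i) 1"
  have s: "state (Suc 1) 2 ?C ?A"
    by (rule state_read[OF after_dummy _ program_nth(2)])
      (simp_all add: length_program exact_digit)
  have "state (Suc (Suc 1)) 3 ?C (?A \<union> {?\<alpha> i |i. i < p \<and> ?\<gamma> i})"
  proof (rule state_select_write[OF s _ program_nth(3)])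
    fix i r assume r: "?C i r"
    \<comment> \<open>For valid darts the address read lies inside the input, so the 1 at the dummy
      address \<open>L\<close> does no harm.\<close>
    have mem: "dg 2 i div 3 \<in> ?A \<longleftrightarrow> w ! (dg 2 i div 3)" if "side n" "dg 2 i < 6 * (n * n)" for n
    proof -
      have "dg 2 i div 3 < L" using that unfolding side_def by linarith
      then show ?thesis by (simp add: input_def)
    qed
    have "r 1 = L" "r 3 = of_bool (dg 2 i div 3 \<in> ?A)" "r 0 = i" using r by simp_all
    then have "exact r edge_exp = of_bool (?\<gamma> i)"
      by (rule exact_edge[THEN trans], intro arg_cong[where f = of_bool])
        (use mem in \<open>auto simp: dart_edges_def\<close>)
    with r show "r 1 = L \<and> exact r edge_exp = of_bool (?\<gamma> i) \<and>
        (?\<gamma> i \<longrightarrow> exact r (table_exp (digit 1) (digit 2) (Const 1)) = ?\<alpha> i)"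
      by (simp add: exact_table exact_digit)
  qed (simp_all add: length_program)
  moreover have "{?\<alpha> i |i. i < p \<and> ?\<gamma> i} = Table (\<lambda>x y l. l = 1 \<and> (x, y) \<in> edges)"
  proof (rule set_eqI, rule iffI)
    fix a assume "a \<in> {?\<alpha> i |i. i < p \<and> ?\<gamma> i}"
    then obtain i where i: "a = ?\<alpha> i" "?\<gamma> i" by blast
    then have "(dg 1 i, dg 2 i) \<in> edges" by (auto simp: edges_def)
    with i(1) show "a \<in> Table (\<lambda>x y l. l = 1 \<and> (x, y) \<in> edges)"
      unfolding Table_def using B_gt_1 dg_less by blast
  next
    fix a assume "a \<in> Table (\<lambda>x y l. l = 1 \<and> (x, y) \<in> edges)"
    then obtain x y n where *: "a = tab x y 1" "x < B" "y < B" "side n" "(x, y) \<in> dart_edges w n"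
      by (auto simp: Table_def edges_def)
    obtain i where "i < p" "dg 0 i = n" "dg 1 i = x" "dg 2 i = y"
      by (rule ex_digits[of n x y 0 0 0]) (use * side_bound B_pos in auto)
    with * show "a \<in> {?\<alpha> i |i. i < p \<and> ?\<gamma> i}" by auto
  qed
  moreover have "Suc (Suc 1) = 3" by simp
  ultimately have "state 3 3 ?C (?A \<union> Table (\<lambda>x y l. l = 1 \<and> (x, y) \<in> edges))"
    by (simp only:)
  then show ?thesis by (rule state_weaken) simp_all
qed

lemma tab_in_memory:
  assumes "x < B" "y < B" "l < B"
  shows "tab x y l \<in> insert L input \<union> Table R \<longleftrightarrow> R x y l"
  using assms tab_bounds[OF assms] by (simp add: tab_in_Table not_in_input)

definition compose :: "(nat \<Rightarrow> nat \<Rightarrow> nat \<Rightarrow> bool) \<Rightarrow> nat \<Rightarrow> nat \<Rightarrow> nat \<Rightarrow> bool" where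
  "compose R x y l \<longleftrightarrow> R x y l \<or>
     (\<exists>z<B. \<exists>l1<B. \<exists>l2<B. l = l1 + l2 \<and> R x z l1 \<and> R z y l2)"

text \<open>Digits 3, 4 and 5 guess the intermediate dart and the two lengths, so one pass performs
  all concatenations at once.\<close>

lemma loop_body:
  assumes s: "state t 4 (\<lambda>i r. idle i r \<and> r 2 = k) (insert L input \<union> Table R)" and k: "k < B"
  shows "state (t + 4) 8 (\<lambda>i r. idle i r \<and> r 2 = 2 * k) (insert L input \<union> Table (compose R))"
proof -
  let ?A = "insert L input \<union> Table R"
  let ?R3 = "\<lambda>i. R (dg 1 i) (dg 3 i) (dg 4 i)" and ?R4 = "\<lambda>i. R (dg 3 i) (dg 2 i) (dg 5 i)"
  let ?C1 = "\<lambda>i r. (idle i r \<and> r 2 = k) \<and> r 3 = of_bool (?R3 i)"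
  let ?C2 = "\<lambda>i r. ?C1 i r \<and> r 4 = of_bool (?R4 i)"
  let ?\<gamma> = "\<lambda>i. ?R3 i \<and> ?R4 i \<and> dg 4 i + dg 5 i < B"
  let ?\<alpha> = "\<lambda>i. tab (dg 1 i) (dg 2 i) (dg 4 i + dg 5 i)"
  have s1: "state (Suc t) 5 ?C1 ?A"
    by (rule state_read[OF s _ program_nth(5)])
      (simp_all add: length_program exact_digit exact_table tab_in_memory del: Un_iff Un_insert_left)
  have s2: "state (Suc (Suc t)) 6 ?C2 ?A"
    by (rule state_read[OF s1 _ program_nth(6)])
      (simp_all add: length_program exact_digit exact_table tab_in_memory del: Un_iff Un_insert_left)
  have s3: "state (Suc (Suc (Suc t))) 7 ?C2 (?A \<union> {?\<alpha> i |i. i < p \<and> ?\<gamma> i})"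
    by (rule state_select_write[OF s2 _ program_nth(7)])
      (simp_all add: length_program exact_digit exact_table exact_base of_bool_arith del: of_bool_conj)
  \<comment> \<open>The doubled counter may exceed \<open>B\<close> but still fits into a
    register.\<close>
  have "2 * k < (L + 2) ^ 12"
  proof -
    have "2 * k < B * B" using k B_gt_2 by (intro mult_strict_mono') auto
    also have "B * B = (L + 2) ^ 4" by (simp only: B_def power4_eq_xxxx mult.assoc)
    also have "\<dots> \<le> (L + 2) ^ 12" by (intro power_increasing) auto
    finally show ?thesis .
  qed
  then have s4: "state (Suc (Suc (Suc (Suc t)))) 8 (\<lambda>i r. idle i r \<and> r 2 = 2 * k)
      (?A \<union> {?\<alpha> i |i. i < p \<and> ?\<gamma> i})"
    by (intro state_assign[OF s3 _ program_nth(8)]) (simp_all add: length_program)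
  have "{?\<alpha> i |i. i < p \<and> ?\<gamma> i} = Table (\<lambda>x y l. \<exists>z<B. \<exists>l1<B. \<exists>l2<B. l = l1 + l2 \<and> R x z l1 \<and> R z y l2)"
    (is "_ = Table ?R")
  proof (rule set_eqI, rule iffI)
    fix a assume "a \<in> {?\<alpha> i |i. i < p \<and> ?\<gamma> i}"
    then show "a \<in> Table ?R" unfolding Table_def using dg_less by blast
  next
    fix a assume "a \<in> Table ?R"
    then obtain x y z l1 l2 where *: "a = tab x y (l1 + l2)" "x < B" "y < B" "z < B" "l1 < B" "l2 < B"
        "l1 + l2 < B" "R x z l1" "R z y l2"
      by (auto simp: Table_def)
    obtain i where "i < p" "dg 1 i = x" "dg 2 i = y" "dg 3 i = z" "dg 4 i = l1" "dg 5 i = l2"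
      by (rule ex_digits[of 0 x y z l1 l2]) (use * B_pos in auto)
    with * show "a \<in> {?\<alpha> i |i. i < p \<and> ?\<gamma> i}" by auto
  qed
  moreover have "Table R \<union> Table ?R = Table (compose R)"
    unfolding Table_def compose_def by blast
  ultimately have "?A \<union> {?\<alpha> i |i. i < p \<and> ?\<gamma> i} = insert L input \<union> Table (compose R)"
    by (simp only: Un_assoc)
  moreover have "t + 4 = Suc (Suc (Suc (Suc t)))" by simp
  ultimately show ?thesis using s4 by (simp only:)
qed

text \<open>A path of positive length starts and ends at edges, whereas the zeroth power relates
  every number to itself.\<close>

lemma relpow_edges_bound:
  assumes "(x, y) \<in> edges ^^ l" "1 \<le> l"
  shows "x < B \<and> y < B"
proof -
  obtain j where j: "l = Suc j" using assms(2) by (cases l) auto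
  have "\<exists>z. (x, z) \<in> edges" using assms(1) unfolding j by (meson relpow_Suc_D2)
  moreover have "\<exists>z. (z, y) \<in> edges" using assms(1) unfolding j by auto
  ultimately show ?thesis using edges_bound by blast
qed

text \<open>Halving walks shows that each round doubles the lengths covered. Each pass takes five
  steps including the test; the test comes last, so none has been made for
  \<open>j = 0\<close>.\<close>

lemma loop:
  assumes "\<forall>i. 0 < i \<longrightarrow> i < j \<longrightarrow> 2 ^ i < B"
  shows "\<exists>R. state (4 + 5 * j) (if j = 0 \<or> 2 ^ j < B then 4 else 9)
      (\<lambda>i r. idle i r \<and> r 2 = 2 ^ j) (insert L input \<union> Table R) \<and>
    (\<forall>x y l. R x y l \<longrightarrow> 1 \<le> l \<and> (x, y) \<in> edges ^^ l) \<and>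
    (\<forall>x y l. 1 \<le> l \<longrightarrow> l \<le> 2 ^ j \<longrightarrow> l < B \<longrightarrow> (x, y) \<in> edges ^^ l \<longrightarrow> R x y l)"
  using assms
proof (induction j)
  case 0
  let ?R = "\<lambda>x y l. l = 1 \<and> (x, y) \<in> edges"
  have "1 < (L + 2) ^ 12" by (rule one_less_power) auto
  then have "state (Suc 3) 4 (\<lambda>i r. idle i r \<and> r 2 = 1) (insert L input \<union> Table ?R)"
    by (intro state_assign[OF after_edges _ program_nth(4)]) (simp_all add: length_program)
  then show ?case by (intro exI[of _ ?R]) auto
next
  case (Suc j)
  let ?pc = "\<lambda>j. if j = 0 \<or> 2 ^ j < B then 4 else 9"
  obtain R where R: "state (4 + 5 * j) (?pc j)
      (\<lambda>i r. idle i r \<and> r 2 = 2 ^ j) (insert L input \<union> Table R)"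
    and sound: "\<And>x y l. R x y l \<Longrightarrow> 1 \<le> l \<and> (x, y) \<in> edges ^^ l"
    and complete: "\<And>x y l. 1 \<le> l \<Longrightarrow> l \<le> 2 ^ j \<Longrightarrow> l < B \<Longrightarrow> (x, y) \<in> edges ^^ l \<Longrightarrow> R x y l"
    using Suc.IH Suc.prems by fastforce
  have j: "2 ^ j < B" using Suc.prems B_gt_1 by (cases "j = 0") auto
  have body: "state (4 + 5 * j + 4) 8 (\<lambda>i r. idle i r \<and> r 2 = 2 * 2 ^ j)
      (insert L input \<union> Table (compose R))"
    by (rule loop_body) (use R j in simp_all)
  have "state (Suc (4 + 5 * j + 4)) (if 2 ^ Suc j < B then 4 else 9)
      (\<lambda>i r. idle i r \<and> r 2 = 2 * 2 ^ j) (insert L input \<union> Table (compose R))"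
    by (rule state_branch[OF body _ program_nth(9)]) (simp_all add: length_program exact_base)
  then have "state (4 + 5 * Suc j) (?pc (Suc j)) (\<lambda>i r. idle i r \<and> r 2 = 2 ^ Suc j)
      (insert L input \<union> Table (compose R))"
    by simp
  moreover have "1 \<le> l \<and> (x, y) \<in> edges ^^ l" if "compose R x y l" for x y l
    using that sound unfolding compose_def by (metis relpow_trans trans_le_add1)
  moreover have "compose R x y l"
    if l: "1 \<le> l" "l \<le> 2 ^ Suc j" "l < B" and xy: "(x, y) \<in> edges ^^ l" for x y l
  proof (cases "l \<le> 2 ^ j")
    case True
    then show ?thesis using complete that by (simp add: compose_def)
  next
    case False
    moreover have "(1::nat) \<le> 2 ^ j" by simp
    ultimately have "2 \<le> l" by linarith
    \<comment> \<open>Both halves are positive as \<open>l\<close> is at least 2, and even the one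
      rounded up is at most \<open>2 ^ j\<close>.\<close>
    define l1 l2 where "l1 = l div 2" and "l2 = l - l div 2"
    have split: "l = l1 + l2" "1 \<le> l1" "1 \<le> l2" "l1 \<le> 2 ^ j" "l2 \<le> 2 ^ j" "l1 < B" "l2 < B"
      using \<open>2 \<le> l\<close> l unfolding l1_def l2_def power_Suc by linarith+
    obtain z where z: "(x, z) \<in> edges ^^ l1" "(z, y) \<in> edges ^^ l2"
      using xy unfolding split(1) relpow_add by blast
    \<comment> \<open>The midpoint is an end of an edge and therefore fits into a digit.\<close>
    then have "z < B" using relpow_edges_bound split by blast
    with z split complete show ?thesis unfolding compose_def by blast
  qed
  ultimately show ?case by blast
qed

section \<open>End of the loop and the starts of walks\<close>

definition rounds :: nat where
  "rounds = (LEAST j. B \<le> 2 ^ j)"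

text \<open>\<open>B\<close> is the square of \<open>L + 2\<close>, which has \<open>lg L\<close>
  binary digits.\<close>

lemma rounds_le: "rounds \<le> 2 * lg L"
proof -
  have "L + 2 \<le> 2 ^ lg L"
    using floorlog_bounds[of "L + 2" 2] by (simp add: lg_def)
  then have "B \<le> 2 ^ lg L * 2 ^ lg L" unfolding B_def by (intro mult_le_mono)
  also have "\<dots> = 2 ^ (2 * lg L)" by (simp only: mult_2 power_add)
  finally show ?thesis unfolding rounds_def by (rule Least_le)
qed

definition M :: "nat set" where
  "M = insert L input \<union> Table (\<lambda>x y l. 1 \<le> l \<and> (x, y) \<in> edges ^^ l) \<union>
     Dom (\<lambda>x l. 1 \<le> l \<and> x \<in> Domain (edges ^^ l))"

lemma after_loop:
  "state (4 + 5 * rounds) 9 idle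
     (insert L input \<union> Table (\<lambda>x y l. 1 \<le> l \<and> (x, y) \<in> edges ^^ l))"
proof -
  have B_le: "B \<le> 2 ^ rounds"
    unfolding rounds_def by (rule LeastI[of _ B]) (simp add: less_imp_le)
  have "2 ^ i < B" if "0 < i" "i < rounds" for i
    using not_less_Least[OF that(2)[unfolded rounds_def]] by simp
  then have "\<forall>i. 0 < i \<longrightarrow> i < rounds \<longrightarrow> 2 ^ i < B" by blast
  from loop[OF this] obtain R where R: "state (4 + 5 * rounds) (if rounds = 0 \<or> 2 ^ rounds < B then 4 else 9)
      (\<lambda>i r. idle i r \<and> r 2 = 2 ^ rounds) (insert L input \<union> Table R)"
    and sound: "\<forall>x y l. R x y l \<longrightarrow> 1 \<le> l \<and> (x, y) \<in> edges ^^ l"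
    and complete: "\<forall>x y l. 1 \<le> l \<longrightarrow> l \<le> 2 ^ rounds \<longrightarrow> l < B \<longrightarrow> (x, y) \<in> edges ^^ l \<longrightarrow> R x y l"
    by (elim exE conjE) (rule that)
  have "rounds \<noteq> 0" using B_le B_gt_1 by (cases rounds) auto
  then have R': "state (4 + 5 * rounds) 9 (\<lambda>i r. idle i r \<and> r 2 = 2 ^ rounds) (insert L input \<union> Table R)"
    using R B_le by simp
  \<comment> \<open>By the choice of \<open>rounds\<close>, completeness covers every length that
    the table can hold.\<close>
  have "l \<le> 2 ^ rounds" if "l < B" for l using that B_le by simp
  then have "R x y l \<longleftrightarrow> 1 \<le> l \<and> (x, y) \<in> edges ^^ l" if "l < B" for x y l
    using that sound complete by blast
  then have "Table R = Table (\<lambda>x y l. 1 \<le> l \<and> (x, y) \<in> edges ^^ l)"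
    by (rule Table_cong)
  then show ?thesis using state_weaken[OF R'] by simp
qed

text \<open>Concurrent writes project the end point away: each processor that finds
  \<open>(x, y, l)\<close> in the table sets the address for \<open>(x, l)\<close>.\<close>

lemma after_domain: "state (6 + 5 * rounds) 11 idle M"
proof -
  let ?R = "\<lambda>x y l. 1 \<le> l \<and> (x, y) \<in> edges ^^ l"
  let ?A = "insert L input \<union> Table ?R"
  let ?C = "\<lambda>i r. idle i r \<and> r 3 = of_bool (?R (dg 1 i) (dg 2 i) (dg 4 i))"
  let ?\<gamma> = "\<lambda>i. ?R (dg 1 i) (dg 2 i) (dg 4 i)"
  let ?\<alpha> = "\<lambda>i. dom (dg 1 i) (dg 4 i)"
  have s1: "state (Suc (4 + 5 * rounds)) 10 ?C ?A"
    by (rule state_read[OF after_loop _ program_nth(10)])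
      (simp_all add: length_program exact_digit exact_table tab_in_memory del: Un_iff Un_insert_left)
  have s2: "state (Suc (Suc (4 + 5 * rounds))) 11 ?C (?A \<union> {?\<alpha> i |i. i < p \<and> ?\<gamma> i})"
    by (rule state_select_write[OF s1 _ program_nth(11)])
      (simp_all add: length_program exact_digit exact_domain)
  have "{?\<alpha> i |i. i < p \<and> ?\<gamma> i} = Dom (\<lambda>x l. 1 \<le> l \<and> x \<in> Domain (edges ^^ l))"
    (is "_ = Dom ?S")
  proof (rule set_eqI, rule iffI)
    fix a assume "a \<in> {?\<alpha> i |i. i < p \<and> ?\<gamma> i}"
    then show "a \<in> Dom ?S" unfolding Dom_def using dg_less by blast
  next
    fix a assume "a \<in> Dom ?S"
    then obtain x l y where *: "a = dom x l" "x < B" "l < B" "1 \<le> l" "(x, y) \<in> edges ^^ l"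
      unfolding Dom_def by blast
    obtain i where "i < p" "dg 1 i = x" "dg 2 i = y" "dg 4 i = l"
      by (rule ex_digits[of 0 x y 0 l 0]) (use * relpow_edges_bound B_pos in auto)
    with * show "a \<in> {?\<alpha> i |i. i < p \<and> ?\<gamma> i}" by auto
  qed
  then have "?A \<union> {?\<alpha> i |i. i < p \<and> ?\<gamma> i} = M" by (simp only: M_def)
  then have "state (Suc (Suc (4 + 5 * rounds))) 11 idle M"
    using state_weaken[OF s2] by simp
  then show ?thesis by simp
qed

lemma
  shows input_in_M: "a < L \<Longrightarrow> a \<in> M \<longleftrightarrow> w ! a"
    and flags_notin_M: "L + 1 \<notin> M" "L + 2 \<notin> M"
    and dom_in_M: "x < B \<Longrightarrow> l < B \<Longrightarrow>
      dom x l \<in> M \<longleftrightarrow> 1 \<le> l \<and> x \<in> Domain (edges ^^ l)"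
proof -
  show "a \<in> M \<longleftrightarrow> w ! a" if "a < L"
    using that not_in_tables[of a] by (simp add: M_def input_def)
  show "L + 1 \<notin> M" "L + 2 \<notin> M"
    using not_in_tables[of "L + 1"] not_in_tables[of "L + 2"]
    by (simp_all add: M_def not_in_input)
  show "dom x l \<in> M \<longleftrightarrow> 1 \<le> l \<and> x \<in> Domain (edges ^^ l)" if "x < B" "l < B"
    using that dom_bound[of x l] dom_not_in_Table[of x l]
    by (simp add: M_def not_in_input dom_in_Dom)
qed

section \<open>Verdict of the machine\<close>

definition marked :: "nat \<Rightarrow> bool" where
  "marked i \<longleftrightarrow> side (dg 0 i) \<and> dg 1 i < 2 * (dg 0 i * dg 0 i) \<and>
     2 * (dg 0 i * dg 0 i) + dg 1 i \<in> M"

definition refuted :: "nat \<Rightarrow> bool" where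
  "refuted i \<longleftrightarrow>
     dg 2 i < 2 * (dg 0 i * dg 0 i) \<and> 2 * (dg 0 i * dg 0 i) + dg 2 i \<in> M \<and> dg 2 i \<noteq> dg 1 i \<or>
     dg 1 i \<in> M \<or>
     of_bool (dom (3 * dg 1 i) (dg 4 i) \<in> M) + of_bool (dom (3 * dg 1 i + 1) (dg 4 i) \<in> M) +
       of_bool (dom (3 * dg 1 i + 2) (dg 4 i) \<in> M) = (1::nat)"

definition accepting :: bool where
  "accepting \<longleftrightarrow> (\<exists>i<p. marked i) \<and> \<not> (\<exists>i<p. marked i \<and> refuted i)"

lemma final:
  "\<exists>C A. state (17 + 5 * rounds) 22 C A \<and> (0 \<in> A \<longleftrightarrow> accepting)"
proof -
  let ?t = "6 + 5 * rounds"
  let ?half = "\<lambda>i. 2 * (dg 0 i * dg 0 i)"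
  let ?C3 = "\<lambda>i r. idle i r \<and> r 3 = of_bool (?half i + dg 1 i \<in> M)"
  let ?C4 = "\<lambda>i r. ?C3 i r \<and> r 4 = of_bool (?half i + dg 2 i \<in> M)"
  let ?C5 = "\<lambda>i r. ?C4 i r \<and> r 5 = of_bool (dg 1 i \<in> M)"
  let ?C6 = "\<lambda>i r. ?C5 i r \<and> r 6 = of_bool (dom (3 * dg 1 i) (dg 4 i) \<in> M)"
  let ?C7 = "\<lambda>i r. ?C6 i r \<and> r 7 = of_bool (dom (3 * dg 1 i + 1) (dg 4 i) \<in> M)"
  let ?C8 = "\<lambda>i r. ?C7 i r \<and> r 8 = of_bool (dom (3 * dg 1 i + 2) (dg 4 i) \<in> M)"
  have s3: "state (Suc ?t) 12 ?C3 M"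
    by (rule state_read[OF after_domain _ program_nth(12)])
      (simp_all add: length_program exact_digit exact_half)
  have s4: "state (Suc (Suc ?t)) 13 ?C4 M"
    by (rule state_read[OF s3 _ program_nth(13)])
      (simp_all add: length_program exact_digit exact_half)
  have s5: "state (Suc (Suc (Suc ?t))) 14 ?C5 M"
    by (rule state_read[OF s4 _ program_nth(14)])
      (simp_all add: length_program exact_digit)
  have s6: "state (Suc (Suc (Suc (Suc ?t)))) 15 ?C6 M"
    by (rule state_read[OF s5 _ program_nth(15)])
      (simp_all add: length_program exact_digit exact_domain)
  have s7: "state (Suc (Suc (Suc (Suc (Suc ?t))))) 16 ?C7 M"
    by (rule state_read[OF s6 _ program_nth(16)])
      (simp_all add: length_program exact_digit exact_domain)
  have s8: "state (Suc (Suc (Suc (Suc (Suc (Suc ?t)))))) 17 ?C8 M"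
    by (rule state_read[OF s7 _ program_nth(17)])
      (simp_all add: length_program exact_digit exact_domain)
  have marked: "exact r marked_exp = of_bool (marked i)" if "?C8 i r" for i r
    unfolding marked_def by (rule exact_marked) (use that in simp_all)
  have refuted: "exact r refuted_exp = of_bool (refuted i)" if "?C8 i r" for i r
    unfolding refuted_def by (rule exact_refuted) (use that in simp_all)
  have dummy: "L \<in> M" by (simp add: M_def)
  let ?M1 = "M \<union> {L + 1 |i. i < p \<and> marked i}"
  have s9: "state (Suc (Suc (Suc (Suc (Suc (Suc (Suc ?t))))))) 18 ?C8 ?M1"
    by (rule state_select_write[OF s8 _ program_nth(18)])
      (use marked dummy in \<open>simp_all add: length_program\<close>)
  let ?M2 = "?M1 \<union> {L + 2 |i. i < p \<and> (marked i \<and> refuted i)}"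
  have s10: "state (Suc (Suc (Suc (Suc (Suc (Suc (Suc (Suc ?t)))))))) 19 ?C8 ?M2"
    by (rule state_select_write[OF s9 _ program_nth(19)])
      (use marked refuted dummy in \<open>simp_all add: length_program of_bool_arith del: of_bool_conj\<close>)
  have s11: "state (Suc (Suc (Suc (Suc (Suc (Suc (Suc (Suc (Suc ?t))))))))) 20
      (\<lambda>i r. idle i r \<and> r 3 = of_bool (L + 1 \<in> ?M2)) ?M2"
    by (rule state_read[OF s10 _ program_nth(20)])
      (simp_all add: length_program del: Un_iff)
  have s12: "state (Suc (Suc (Suc (Suc (Suc (Suc (Suc (Suc (Suc (Suc ?t)))))))))) 21
      (\<lambda>i r. (idle i r \<and> r 3 = of_bool (L + 1 \<in> ?M2)) \<and> r 4 = of_bool (L + 2 \<in> ?M2)) ?M2"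
    by (rule state_read[OF s11 _ program_nth(21)])
      (simp_all add: length_program del: Un_iff)
  let ?v = "L + 1 \<in> ?M2 \<and> L + 2 \<notin> ?M2"
  \<comment> \<open>The verdict replaces whatever address 0 held before, so it may have to be
    cleared as well as set.\<close>
  let ?A = "if ?v then ?M2 \<union> (\<lambda>i. 0) ` {..<p} else ?M2 - (\<lambda>i. 0) ` {..<p}"
  let ?C = "\<lambda>i r. (idle i r \<and> r 3 = of_bool (L + 1 \<in> ?M2)) \<and> r 4 = of_bool (L + 2 \<in> ?M2)"
  have "state (Suc (Suc (Suc (Suc (Suc (Suc (Suc (Suc (Suc (Suc (Suc ?t))))))))))) 22 ?C ?A"
    by (rule state_write[OF s12 _ program_nth(22)])
      (simp_all add: length_program not_exp_def of_bool_arith del: Un_iff of_bool_conj)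
  then have "state (17 + 5 * rounds) 22 ?C ?A" by simp
  moreover have "0 \<in> ?A \<longleftrightarrow> ?v" using p_pos by auto
  moreover have "?v \<longleftrightarrow> accepting"
    using flags_notin_M by (auto simp: accepting_def)
  ultimately show ?thesis by blast
qed

section \<open>Correctness of the verdict\<close>

lemma side_unique: "side n \<Longrightarrow> side n' \<Longrightarrow> n = n'"
  unfolding side_def by (metis mult_left_cancel power2_eq_square power2_eq_imp_eq zero_le zero_neq_numeral)

lemma edges_eq: "side n \<Longrightarrow> edges = dart_edges w n"
  using side_unique by (auto simp: edges_def)

lemma dom_in_M_iff:
  assumes side: "side n" and x: "x < 2 * (n * n)" and l: "l < B" and d: "d < 3"
  shows "dom (3 * x + d) l \<in> M \<longleftrightarrow> 1 \<le> l \<and> 3 * x + d \<in> Domain (dart_edges w n ^^ l)"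
proof -
  have "3 * x + d < B" using side_bound(1)[OF side] x d by linarith
  then show ?thesis using dom_in_M l by (simp add: edges_eq[OF side])
qed

text \<open>Conditions on processors become quantifiers over the guesses \<open>n\<close>,
  \<open>x\<close>, \<open>y\<close>, \<open>l\<close>. As the dimension and the mark are unique,
  the existence of a mark and the absence of refutations speak of one cell, to which
  \<open>Stability_iff\<close> applies.\<close>

lemma accepting_iff: "accepting \<longleftrightarrow> w \<in> Stability {2}"
proof -
  let ?mark = "\<lambda>n x. x < 2 * (n * n) \<and> w ! (2 * (n * n) + x)"
  let ?N = "\<lambda>n x l. of_bool (3 * x \<in> Domain (dart_edges w n ^^ l)) +
    of_bool (3 * x + 1 \<in> Domain (dart_edges w n ^^ l)) +
    of_bool (3 * x + 2 \<in> Domain (dart_edges w n ^^ l)) :: nat"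
  have in_half: "2 * (n * n) + x \<in> M \<longleftrightarrow> w ! (2 * (n * n) + x)" "x \<in> M \<longleftrightarrow> w ! x" "x < B"
    if "side n" "x < 2 * (n * n)" for n x
    using that side_bound(1)[of n] by (auto simp: side_def intro!: input_in_M)
  have marked: "marked i \<longleftrightarrow> side (dg 0 i) \<and> ?mark (dg 0 i) (dg 1 i)" for i
    using in_half by (auto simp: marked_def)
  \<comment> \<open>For \<open>l = 0\<close> the table has no entries, so the left count is 0 while
    the right one is 3; neither equals 1.\<close>
  have N: "of_bool (dom (3 * x) l \<in> M) + of_bool (dom (3 * x + 1) l \<in> M) +
      of_bool (dom (3 * x + 2) l \<in> M) = (1::nat) \<longleftrightarrow> ?N n x l = 1"
    if "side n" "x < 2 * (n * n)" "l < B" for n x l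
    using dom_in_M_iff[OF that, of 0] dom_in_M_iff[OF that, of 1] dom_in_M_iff[OF that, of 2]
    by (cases "l = 0") simp_all
  let ?bad = "\<lambda>n x y l. ?mark n y \<and> y \<noteq> x \<or> w ! x \<or> ?N n x l = 1"
  have refuted: "refuted i \<longleftrightarrow> ?bad (dg 0 i) (dg 1 i) (dg 2 i) (dg 4 i)" if "marked i" for i
  proof -
    have i: "side (dg 0 i)" "dg 1 i < 2 * (dg 0 i * dg 0 i)" using that marked by auto
    show ?thesis
      unfolding refuted_def N[OF i dg_less] in_half(2)[OF i] using in_half(1)[OF i(1)] by blast
  qed
  have "(\<exists>i<p. marked i) \<longleftrightarrow> (\<exists>n x. side n \<and> ?mark n x)"
  proof
    assume "\<exists>n x. side n \<and> ?mark n x"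
    then obtain n x where *: "side n" "?mark n x" by blast
    obtain i where "i < p" "dg 0 i = n" "dg 1 i = x"
      by (rule ex_digits[of n x 0 0 0 0]) (use * side_bound in_half B_pos in auto)
    with * show "\<exists>i<p. marked i" using marked by blast
  qed (use marked in blast)
  moreover have "(\<exists>i<p. marked i \<and> refuted i) \<longleftrightarrow>
      (\<exists>n x y l. side n \<and> ?mark n x \<and> y < B \<and> l < B \<and> ?bad n x y l)"
  proof
    assume "\<exists>i<p. marked i \<and> refuted i"
    then obtain i where "marked i" "refuted i" by blast
    then have "side (dg 0 i) \<and> ?mark (dg 0 i) (dg 1 i) \<and> dg 2 i < B \<and> dg 4 i < B \<and>
        ?bad (dg 0 i) (dg 1 i) (dg 2 i) (dg 4 i)"
      using marked[of i] refuted[of i] dg_less by blast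
    then show "\<exists>n x y l. side n \<and> ?mark n x \<and> y < B \<and> l < B \<and> ?bad n x y l" by blast
  next
    assume "\<exists>n x y l. side n \<and> ?mark n x \<and> y < B \<and> l < B \<and> ?bad n x y l"
    then obtain n x y l where *: "side n" "?mark n x" "y < B" "l < B" "?bad n x y l" by blast
    obtain i where i: "i < p" "dg 0 i = n" "dg 1 i = x" "dg 2 i = y" "dg 4 i = l"
      by (rule ex_digits[of n x y 0 l 0]) (use * side_bound in_half B_pos in auto)
    have "marked i" using marked[of i] * i by simp
    then have "refuted i" using refuted[of i] i *(5) by simp
    with \<open>marked i\<close> show "\<exists>i<p. marked i \<and> refuted i" using i by blast
  qed
  ultimately have "accepting \<longleftrightarrow> (\<exists>n x. side n \<and> ?mark n x) \<and>
      \<not> (\<exists>n x y l. side n \<and> ?mark n x \<and> y < B \<and> l < B \<and> ?bad n x y l)"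
    by (simp only: accepting_def)
  also have "\<dots> \<longleftrightarrow> (\<exists>n x. side n \<and> x < 2 * (n * n) \<and>
      (\<forall>y<2 * (n * n). w ! (2 * (n * n) + y) \<longleftrightarrow> y = x) \<and> \<not> w ! x \<and> (\<forall>l<B. ?N n x l \<noteq> 1))"
    (is "?lhs \<longleftrightarrow> (\<exists>n x. ?S n x)")
  proof
    assume lhs: ?lhs
    then obtain n x where nx: "side n" "?mark n x" by blast
    have good: "\<not> ?bad n x y l" if "y < B" "l < B" for y l
      using lhs nx that by blast
    \<comment> \<open>A second mark refutes together with any length, for instance 0.\<close>
    have "w ! (2 * (n * n) + y) \<longleftrightarrow> y = x" if "y < 2 * (n * n)" for y
      using good[of y 0] that in_half(3)[OF nx(1) that] nx B_pos by blast
    moreover have "\<not> w ! x" "\<forall>l<B. ?N n x l \<noteq> 1"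
      using good[of 0] B_pos by blast+
    ultimately have "?S n x" using nx by blast
    then show "\<exists>n x. ?S n x" by blast
  next
    assume "\<exists>n x. ?S n x"
    then obtain n x where nx: "?S n x" by blast
    then have "side n \<and> ?mark n x" by blast
    moreover have "\<not> (side n' \<and> ?mark n' x' \<and> y < B \<and> l < B \<and> ?bad n' x' y l)" for n' x' y l
    proof
      assume *: "side n' \<and> ?mark n' x' \<and> y < B \<and> l < B \<and> ?bad n' x' y l"
      \<comment> \<open>Any other marked pair coincides with the given one: the dimension is unique
        and only \<open>x\<close> is marked.\<close>
      then have "n' = n" using nx side_unique by blast
      moreover from this have "x' = x" using nx * by blast
      ultimately show False using * nx by blast
    qed
    ultimately show ?lhs by blast
  qed
  also have "\<dots> \<longleftrightarrow> w \<in> Stability {2}"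
  proof -
    have "?S n x \<longleftrightarrow> 1 \<le> n \<and> L = 4 * (n * n) \<and> x < 2 * (n * n) \<and>
        (\<forall>y<2 * (n * n). w ! (2 * (n * n) + y) \<longleftrightarrow> y = x) \<and> \<not> w ! x \<and>
        stable {2} (\<lambda>u. w ! index n u) (cell_of n x)" for n x
    proof (cases "side n \<and> x < 2 * (n * n) \<and> \<not> w ! x")
      case True
      then have "stable {2} (\<lambda>u. w ! index n u) (cell_of n x) \<longleftrightarrow> (\<forall>l<B. ?N n x l \<noteq> 1)"
        by (intro stable_iff_relpow) (use side_bound in \<open>auto simp: side_def\<close>)
      with True show ?thesis by (simp only: side_def) blast
    next
      case False
      then show ?thesis unfolding side_def by blast
    qed
    then show ?thesis unfolding Stability_iff by (simp only:)
  qed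
  finally show ?thesis .
qed

section \<open>Running time and membership in NC\<close>

lemma accepts:
  "\<exists>t\<le>27 * lg L ^ 27. halted p program (run t) \<and> (mem (run t) 0 = 1 \<longleftrightarrow> w \<in> Stability {2})"
proof -
  obtain C A where s: "state (17 + 5 * rounds) 22 C A" and A: "0 \<in> A \<longleftrightarrow> accepting"
    using final by blast
  have "halted p program (run (17 + 5 * rounds))"
    using s by (simp add: state_def halted_def fetch_def length_program)
  moreover have "mem (run (17 + 5 * rounds)) 0 = 1 \<longleftrightarrow> w \<in> Stability {2}"
    using s A accepting_iff by (simp add: state_def)
  \<comment> \<open>The time is at most \<open>17 + 10 * lg L\<close>, and \<open>lg L\<close> is
    positive, so the factor 27 suffices; \<open>NC\<close> uses the same constant as
    exponent.\<close>
  moreover have "17 + 5 * rounds \<le> 27 * lg L ^ 27"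
  proof -
    have lg: "1 \<le> lg L" by (simp add: lg_def floorlog_def)
    have "lg L ^ 1 \<le> lg L ^ 27" using lg by (intro power_increasing) auto
    with lg rounds_le show ?thesis by simp
  qed
  ultimately show ?thesis by blast
qed

end

theorem theorem2: "Stability {2} \<in> NC"
proof -
  \<comment> \<open>The sum bounds the exponent of every instruction, and the summand 12 makes
    processor numbers fit into words.\<close>
  define b where "b = 12 + sum_list (map (instr_expo 12) program)"
  have "\<exists>t\<le>27 * lg (length w) ^ 27.
      let s = (pram_step (2 ^ (b * lg (length w))) ((length w + 2) ^ 12) program ^^ t) (pram_init w)
      in halted ((length w + 2) ^ 12) program s \<and> (mem s 0 = 1 \<longleftrightarrow> w \<in> Stability {2})" for w
  proof -
    interpret stability_run w "2 ^ (b * lg (length w))" "(length w + 2) ^ 12" b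
    proof
      show "instr_expo 12 ins \<le> b" if "ins \<in> set program" for ins
        using member_le_sum_list[of "instr_expo 12 ins" "map (instr_expo 12) program"] that
        by (simp add: b_def)
      have "length w + 2 \<le> 2 ^ lg (length w)"
        using floorlog_bounds[of "length w + 2" 2] by (simp add: lg_def)
      then have "(length w + 2) ^ b \<le> (2 ^ lg (length w)) ^ b" by (rule power_mono) simp
      then show "(length w + 2) ^ b \<le> 2 ^ (b * lg (length w))"
        by (simp only: power_mult[symmetric] mult.commute)
    qed simp_all
    show ?thesis using accepts by (simp only: run_def Let_def)
  qed
  moreover have "0 < (12::nat)" "12 \<le> b" by (simp_all add: b_def)
  ultimately show ?thesis unfolding NC_def Let_def by blast
qed

end
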